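(* Let $\mu$ be the probability measure on the Farey group $\Gamma$ given by $\mu(\{a\})=\mu(\{b\})=\mu(\{c\})=\frac13$. The extended Minkowski measure $\mu_{\bar{\mathcal{M}}}$ on $X=P(\mathbb{R}^2)$ is stationary with respect to the random walk generated by $\mu$, i.e. $\mu*\mu_{\bar{\mathcal{M}}}=\mu_{\bar{\mathcal{M}}}$.
   Context: Action: $PSL(2,\mathbb{R})$ acts on the projective line $X=P(\mathbb{R}^2)$ through the linear action on $\mathbb{R}^2$. $X$ is identified with $\mathbb{R}\cup\{\infty\}$ by sending the class of $(x,y)^T$ to $x/y$ if $y\neq0$ and the class of $(1,0)^T$ to $\infty$; the action becomes the action by Möbius transformations. Farey group: the subgroup $\Gamma$ of $PSL(2,\mathbb{Z})$ generated by the classes of $$a=\begin{pmatrix}1&-2\\1&-1\end{pmatrix},\quad b=\begin{pmatrix}0&-1\\1&0\end{pmatrix},\quad c=\begin{pmatrix}1&-1\\2&-1\end{pmatrix}.$$ Convolution: for a probability measure $\mu$ on $\Gamma$ and a measure $\pi$ on $X$, $\int_X f\,d(\mu*\pi)=\int_\Gamma\int_X f(gx)\,d\pi(x)\,d\mu(g)$. Farey sequences: for rationals in lowest terms with positive denominators, $\frac{p_1}{q_1}\oplus\frac{p_2}{q_2}=\frac{p_1+p_2}{q_1+q_2}$. Set $\mathscr{F}_0=(0,1)$ (with $0=\frac01$, $1=\frac11$), and let $\mathscr{F}_{n+1}$ be obtained from $\mathscr{F}_n$ by inserting $s\oplus t$ between every two consecutive terms $s,t$. Each $\mathscr{F}_n$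 is increasing and has $2^n+1$ terms. Minkowski function: $\mathcal{M}:[0,1]\to[0,1]$ is the unique continuous function such that $\mathcal{M}(q)=k/2^n$ whenever $q$ is the $(k+1)$-th term of $\mathscr{F}_n$ (this does not depend on the choice of $n$). Extended Minkowski measure: for $n\in\mathbb{Z}$ and $q\in[n,n+1)$, with $\{q\}$ the fractional part, let $$\bar{\mathcal{M}}(q)=\frac13\left(\sum_{k=-\infty}^{n-1}\frac1{2^{|k|}}+\frac{\mathcal{M}(\{q\})}{2^{|n|}}\right).$$ Then $\mu_{\bar{\mathcal{M}}}$ is the Borel probability measure on $\mathbb{R}$ with $\mu_{\bar{\mathcal{M}}}([s,t))=\bar{\mathcal{M}}(t)-\bar{\mathcal{M}}(s)$ for $s<t$, viewed as a measure on $X=\mathbb{R}\cup\{\infty\}$ giving mass $0$ to $\infty$. *)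

theory Defs
  imports
    "HOL-Probability.Probability_Measure"
    "HOL-Algebra.Coset"
    "HOL-Algebra.Generated_Groups"
begin

section \<open>The projective line\<close>

text \<open>
  Points are classes of nonzero vectors; \<open>abs_proj_line v\<close> is the class of \<open>v\<close>, and is
  meaningful only for \<open>v \<noteq> 0\<close>.
\<close>

quotient_type proj_line = "real^2" / partial:
  "\<lambda>u v. u \<noteq> 0 \<and> v \<noteq> 0 \<and> (\<exists>c::real. c \<noteq> 0 \<and> v = c *\<^sub>R u)"
proof (rule part_equivpI)
  let ?R = "\<lambda>u v :: real^2. u \<noteq> 0 \<and> v \<noteq> 0 \<and> (\<exists>c::real. c \<noteq> 0 \<and> v = c *\<^sub>R u)"
  show "\<exists>x. ?R x x"
    by (intro exI[of _ "axis 1 1"] conjI exI[of _ "1::real"]) (simp_all add: axis_eq_0_iff)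
  show "symp ?R"
  proof (rule sympI)
    fix u v :: "real^2"
    assume "?R u v"
    then obtain c :: real where "u \<noteq> 0" "v \<noteq> 0" "c \<noteq> 0" "v = c *\<^sub>R u"
      by blast
    then show "?R v u"
      by (intro conjI exI[of _ "inverse c"]) auto
  qed
  show "transp ?R"
  proof (rule transpI)
    fix u v w :: "real^2"
    assume "?R u v" "?R v w"
    then obtain c d :: real where "u \<noteq> 0" "w \<noteq> 0" "c \<noteq> 0" "v = c *\<^sub>R u" "d \<noteq> 0" "w = d *\<^sub>R v"
      by blast
    then show "?R u w"
      by (intro conjI exI[of _ "d * c"]) auto
  qed
qed

text \<open>
  The quotient topology. Since the complement of the origin is open, openness in
  \<^typ>\<open>real^2\<close> and in that complement agree.
\<close>

instantiation proj_line :: topological_space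
begin

definition open_proj_line :: "proj_line set \<Rightarrow> bool" where
  "open_proj_line U \<longleftrightarrow> open {v :: real^2. v \<noteq> 0 \<and> abs_proj_line v \<in> U}"

instance
proof
  have "{v :: real^2. v \<noteq> 0 \<and> abs_proj_line v \<in> UNIV} = - {0}"
    by auto
  then show "open (UNIV :: proj_line set)"
    unfolding open_proj_line_def by (simp only: open_Compl closed_singleton)
next
  fix S T :: "proj_line set"
  assume "open S" "open T"
  moreover have "{v :: real^2. v \<noteq> 0 \<and> abs_proj_line v \<in> S \<inter> T} =
      {v. v \<noteq> 0 \<and> abs_proj_line v \<in> S} \<inter> {v. v \<noteq> 0 \<and> abs_proj_line v \<in> T}"
    by auto
  ultimately show "open (S \<inter> T)"
    unfolding open_proj_line_def by (simp only: open_Int)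
next
  fix K :: "proj_line set set"
  assume "\<forall>S\<in>K. open S"
  moreover have "{v :: real^2. v \<noteq> 0 \<and> abs_proj_line v \<in> \<Union>K} =
      (\<Union>S\<in>K. {v. v \<noteq> 0 \<and> abs_proj_line v \<in> S})"
    by auto
  ultimately show "open (\<Union>K)"
    unfolding open_proj_line_def by (simp only: open_UN)
qed

end

text \<open>
  The class of \<open>(x, y)\<close> with \<open>y \<noteq> 0\<close> corresponds to the real number \<open>x / y\<close>; the only point
  not in the range is the class of \<open>(1, 0)\<close>, that is \<open>\<infinity>\<close>.
\<close>

definition proj_of_real :: "real \<Rightarrow> proj_line" where
  "proj_of_real x = abs_proj_line (vector [x, 1])"

section \<open>\<open>PSL(2,\<real>)\<close>, its action, and the Farey group\<close>

definition SL2R :: "(real^2^2) monoid" where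
  "SL2R = \<lparr>carrier = {A. det A = 1}, monoid.mult = (\<lambda>A B. A ** B), one = mat 1\<rparr>"

definition PSL2R :: "(real^2^2) set monoid" where
  "PSL2R = SL2R Mod {mat 1, - mat 1}"

definition psl_class :: "real^2^2 \<Rightarrow> (real^2^2) set" where
  "psl_class A = {mat 1, - mat 1} #>\<^bsub>SL2R\<^esub> A"

definition PSL2Z :: "(real^2^2) set monoid" where
  "PSL2Z = PSL2R\<lparr>carrier := psl_class ` {A. det A = 1 \<and> (\<forall>i j. A $ i $ j \<in> \<int>)}\<rparr>"

definition psl_act :: "(real^2^2) set \<Rightarrow> proj_line \<Rightarrow> proj_line" where
  "psl_act g x =
    (THE y. \<exists>A\<in>g. \<exists>v. v \<noteq> 0 \<and> x = abs_proj_line v \<and> y = abs_proj_line (A *v v))"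

definition farey_a :: "(real^2^2) set" where
  "farey_a = psl_class (vector [vector [1, -2], vector [1, -1]])"

definition farey_b :: "(real^2^2) set" where
  "farey_b = psl_class (vector [vector [0, -1], vector [1, 0]])"

definition farey_c :: "(real^2^2) set" where
  "farey_c = psl_class (vector [vector [1, -1], vector [2, -1]])"

definition farey_group :: "(real^2^2) set set" where
  "farey_group = generate PSL2Z {farey_a, farey_b, farey_c}"

section \<open>Convolution\<close>

text \<open>
  The defining integral identity is required of all nonnegative Borel functions, so that no
  integrability condition is needed.
\<close>

definition psl_convolution ::
    "(real^2^2) set measure \<Rightarrow> proj_line measure \<Rightarrow> proj_line measure" where
  "psl_convolution \<mu> \<pi> = (THE \<nu>. sets \<nu> = sets borel \<and>
    (\<forall>f \<in> borel_measurable borel.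
      (\<integral>\<^sup>+x. f x \<partial>\<nu>) = (\<integral>\<^sup>+g. (\<integral>\<^sup>+x. f (psl_act g x) \<partial>\<pi>) \<partial>\<mu>)))"

section \<open>Farey sequences and the Minkowski measure\<close>

text \<open>
  \<^const>\<open>quotient_of\<close> returns numerator and denominator in lowest terms, with positive
  denominator.
\<close>

definition mediant :: "rat \<Rightarrow> rat \<Rightarrow> rat" where
  "mediant s t =
    (case quotient_of s of (p1, q1) \<Rightarrow>
     case quotient_of t of (p2, q2) \<Rightarrow> Fract (p1 + p2) (q1 + q2))"

fun insert_mediants :: "rat list \<Rightarrow> rat list" where
  "insert_mediants (s # t # xs) = s # mediant s t # insert_mediants (t # xs)"
| "insert_mediants xs = xs"

definition farey :: "nat \<Rightarrow> rat list" where
  "farey n = (insert_mediants ^^ n) [0, 1]"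

text \<open>
  Membership in \<^term>\<open>extensional {0..1}\<close> only fixes the irrelevant values outside the unit
  interval, which uniqueness of a total HOL function requires.
\<close>

definition minkowski :: "real \<Rightarrow> real" where
  "minkowski = (THE M. M \<in> extensional {0..1} \<and> M ` {0..1} \<subseteq> {0..1} \<and>
    continuous_on {0..1} M \<and>
    (\<forall>n k. k \<le> 2 ^ n \<longrightarrow> M (of_rat (farey n ! k)) = real k / 2 ^ n))"

definition minkowski_ext :: "real \<Rightarrow> real" where
  "minkowski_ext q =
    1 / 3 * ((\<Sum>\<^sub>\<infinity>k\<in>{..\<lfloor>q\<rfloor> - 1}. 1 / 2 ^ nat \<bar>k\<bar>) + minkowski (frac q) / 2 ^ nat \<bar>\<lfloor>q\<rfloor>\<bar>)"

definition minkowski_measure_real :: "real measure" where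
  "minkowski_measure_real = (THE N. prob_space N \<and> sets N = sets borel \<and>
    (\<forall>s t. s < t \<longrightarrow> measure N {s..<t} = minkowski_ext t - minkowski_ext s))"

definition minkowski_measure :: "proj_line measure" where
  "minkowski_measure = distr minkowski_measure_real borel proj_of_real"

end

theory Submission
  imports Defs "HOL-Probability.Distribution_Functions"
begin

text \<open>
The generators \<open>a\<close>, \<open>b\<close>, \<open>c\<close> are hyperbolic half-turns about points on the sides of the
ideal triangle with vertices \<open>0\<close>, \<open>1\<close>, \<open>\<infinity>\<close>: as Moebius maps \<open>a\<close> exchanges \<open>1\<close> and \<open>\<infinity>\<close>, \<open>b\<close> exchanges \<open>0\<close>
and \<open>\<infinity>\<close>, and \<open>c\<close> exchanges \<open>0\<close> and \<open>1\<close>. The extended Minkowski measure gives mass \<open>1/3\<close> to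
each of the three arcs between the vertices and halves this mass at every Farey subdivision. A
generator carries the Farey intervals inside the arc cut off by its own side to Farey intervals
one level higher up, and those of the other two arcs to intervals one level deeper. Hence the
image of the measure under one generator has density \<open>2\<close> on one arc and density \<open>1/2\<close> on the
other two, and on each arc the three densities add up to \<open>2 + 1/2 + 1/2 = 3\<close>.

In the proof this is expressed by distribution functions. The Minkowski function \<open>M\<close> satisfies
\<open>M (1 - x) = 1 - M x\<close> and \<open>M (x / (1 + x)) = M x / 2\<close>. A monotone continuous solution of these
equations arises as the limit of a contraction (\<open>question_mark_exists\<close>). It takes the prescribed
values on the Farey sequences because each sequence consists of two Moebius copies of the
preceding one (\<open>farey_self_similar\<close>), and the same self-similarity shows that the Farey
fractions are dense, so that it is the only such function (\<open>minkowski_characterisation\<close>).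
For the extended function \<open>F\<close> the two equations give a reflection and a shift, hence the
rotation \<open>F (1 - 1/t) = F t - 1/3\<close> and the inversion \<open>F (- 1/t) = (F t - 1/3) / 2\<close> for \<open>t > 0\<close>
(\<open>minkowski_ext_rotate\<close>, \<open>minkowski_ext_inversion\<close>). They determine the distribution functions
of the three images, whose average is \<open>F\<close> (\<open>nn_integral_minkowski_stationary\<close>). Since \<open>F\<close> is
continuous the measure has no atoms, so the poles of the three maps are negligible and the identity
passes to the projective line.
\<close>

section \<open>A monotone continuous solution of the functional equations\<close>

text \<open>
The iterates, started at the identity, of the operator that encodes the two functional equations:
on the left half \<open>x = u / (1 + u)\<close> with \<open>u = x / (1 - x)\<close>, and on the right half
\<open>1 - x = u / (1 + u)\<close> with \<open>u = (1 - x) / x\<close>. The operator contracts the supremum distance by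
the factor \<open>1/2\<close>.
\<close>

primrec question_mark_iter :: "nat \<Rightarrow> real \<Rightarrow> real" where
  "question_mark_iter 0 x = x"
| "question_mark_iter (Suc n) x =
    (if x \<le> 1/2 then question_mark_iter n (x / (1 - x)) / 2
     else 1 - question_mark_iter n ((1 - x) / x) / 2)"

lemma inner_branch_in_unit:
  fixes x :: real
  assumes "0 \<le> x" "x \<le> 1/2"
  shows "x / (1 - x) \<in> {0..1}"
  using assms by (auto simp: field_simps)

lemma outer_branch_in_unit:
  fixes x :: real
  assumes "1/2 \<le> x" "x \<le> 1"
  shows "(1 - x) / x \<in> {0..1}"
  using assms by (auto simp: field_simps)

lemma question_mark_iter_endpoints:
  "question_mark_iter n 0 = 0" "question_mark_iter n 1 = 1"
  by (induction n) auto

lemma question_mark_iter_mono: "mono_on {0..1} (question_mark_iter n)"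
proof (induction n)
  case 0
  then show ?case by (auto intro: mono_onI)
next
  case (Suc n)
  have le: "question_mark_iter n u \<le> question_mark_iter n v" if "0 \<le> u" "u \<le> v" "v \<le> 1" for u v
    using mono_onD[OF Suc, of u v] that by auto
  have le1: "question_mark_iter n u \<le> 1" if "u \<in> {0..1}" for u
    using le[of u 1] that question_mark_iter_endpoints[of n] by auto
  show ?case
  proof (rule mono_onI)
    fix x y :: real
    assume xy: "x \<in> {0..1}" "y \<in> {0..1}" "x \<le> y"
    consider "y \<le> 1/2" | "x \<le> 1/2" "1/2 < y" | "1/2 < x"
      using xy by linarith
    then show "question_mark_iter (Suc n) x \<le> question_mark_iter (Suc n) y"
    proof cases
      case 1
      have "x / (1 - x) \<le> y / (1 - y)" using xy 1 by (intro frac_le) auto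
      then show ?thesis using xy 1 inner_branch_in_unit[of x] inner_branch_in_unit[of y]
        by (auto intro!: le)
    next
      case 2
      then show ?thesis
        using xy le1[OF inner_branch_in_unit[of x]] le1[OF outer_branch_in_unit[of y]] by auto
    next
      case 3
      have "(1 - y) / y \<le> (1 - x) / x" using xy 3 by (intro frac_le) auto
      then show ?thesis using xy 3 outer_branch_in_unit[of x] outer_branch_in_unit[of y]
        by (auto intro!: le)
    qed
  qed
qed

lemma question_mark_iter_in_unit:
  assumes "x \<in> {0..1}"
  shows "question_mark_iter n x \<in> {0..1}"
  using mono_onD[OF question_mark_iter_mono, of 0 x n] mono_onD[OF question_mark_iter_mono, of x 1 n]
    assms question_mark_iter_endpoints[of n] by auto

lemma question_mark_iter_continuous: "continuous_on {0..1} (question_mark_iter n)"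
proof (induction n)
  case 0
  then show ?case by simp
next
  case (Suc n)
  have inner: "continuous_on {x \<in> {0..1}. x \<le> 1/2} (\<lambda>x. question_mark_iter n (x / (1 - x)) / 2)"
    by (intro continuous_intros continuous_on_compose2[OF Suc]) (auto simp: field_simps)
  have outer: "continuous_on {x \<in> {0..1}. 1/2 \<le> x} (\<lambda>x. 1 - question_mark_iter n ((1 - x) / x) / 2)"
    by (intro continuous_intros continuous_on_compose2[OF Suc]) (auto simp: field_simps)
  have agree: "question_mark_iter n (x / (1 - x)) / 2 = 1 - question_mark_iter n ((1 - x) / x) / 2"
    if "x = 1/2" for x
    unfolding that by (simp add: question_mark_iter_endpoints)
  have "continuous_on {0..1} (\<lambda>x. if x \<le> 1/2 then question_mark_iter n (x / (1 - x)) / 2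
     else 1 - question_mark_iter n ((1 - x) / x) / 2)"
    by (rule continuous_on_cases_le[OF inner outer _ agree]) auto
  then show ?case by simp
qed

lemma question_mark_iter_step:
  assumes "x \<in> {0..1}"
  shows "\<bar>question_mark_iter (Suc n) x - question_mark_iter n x\<bar> \<le> (1/2) ^ n"
  using assms
proof (induction n arbitrary: x)
  case 0
  then show ?case using question_mark_iter_in_unit[of x "Suc 0"]
    by (auto simp del: question_mark_iter.simps(2))
next
  case (Suc n)
  \<comment> \<open>Both steps at \<open>x\<close> use the same branch, which halves the difference at the same point \<open>u\<close>.\<close>
  define u where "u = (if x \<le> 1/2 then x / (1 - x) else (1 - x) / x)"
  have u: "u \<in> {0..1}"
    using inner_branch_in_unit[of x] outer_branch_in_unit[of x] Suc.prems by (auto simp: u_def)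
  have halve: "\<bar>a / 2 - b / 2\<bar> = \<bar>a - b\<bar> / 2" "\<bar>1 - a / 2 - (1 - b / 2)\<bar> = \<bar>a - b\<bar> / 2"
    for a b :: real
    by (auto simp: abs_if field_simps)
  have "\<bar>question_mark_iter (Suc (Suc n)) x - question_mark_iter (Suc n) x\<bar>
      = \<bar>question_mark_iter (Suc n) u - question_mark_iter n u\<bar> / 2"
    unfolding question_mark_iter.simps(2)[of "Suc n" x] question_mark_iter.simps(2)[of n x] u_def
    by (cases "x \<le> 1/2") (simp_all only: if_True if_False halve)
  then show ?case using Suc.IH[OF u] by (simp del: question_mark_iter.simps)
qed

text \<open>
The steps between successive iterates are dominated by a geometric series, so the iterates
converge uniformly. Monotonicity and continuity survive the limit, and the limit is a fixed point
of the operator, which says exactly that it satisfies the functional equations.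
\<close>

lemma question_mark_exists:
  obtains M :: "real \<Rightarrow> real" where
    "continuous_on {0..1} M" "mono_on {0..1} M" "M 0 = 0" "M 1 = 1"
    "\<And>x. x \<in> {0..1} \<Longrightarrow> M (x / (1 + x)) = M x / 2"
    "\<And>x. x \<in> {0..1} \<Longrightarrow> M (1 - x) = 1 - M x"
proof -
  define d where "d n x = question_mark_iter (Suc n) x - question_mark_iter n x" for n x
  define M where "M x = (\<Sum>n. d n x) + x" for x
  have "uniform_limit {0..1} (\<lambda>n x. \<Sum>i<n. d i x) (\<lambda>x. suminf (\<lambda>i. d i x)) sequentially"
  proof (rule Weierstrass_m_test)
    show "norm (d n x) \<le> (1/2) ^ n" if "x \<in> {0..1}" for n x
      unfolding d_def real_norm_def by (rule question_mark_iter_step[OF that])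
    show "summable (\<lambda>n. (1/2::real) ^ n)" by (rule summable_geometric) simp
  qed
  then have "uniform_limit {0..1} (\<lambda>n x. (\<Sum>i<n. d i x) + x) M sequentially"
    unfolding M_def by (intro uniform_limit_intros)
  moreover have "(\<Sum>i<n. d i x) + x = question_mark_iter n x" for n x
    unfolding d_def by (subst sum_lessThan_telescope) simp
  ultimately have lim: "uniform_limit {0..1} question_mark_iter M sequentially"
    by simp
  have cont: "continuous_on {0..1} M"
    by (rule uniform_limit_theorem[OF _ lim]) (auto simp: question_mark_iter_continuous)
  have ptlim: "(\<lambda>n. question_mark_iter n x) \<longlonglongrightarrow> M x" if "x \<in> {0..1}" for x
    using tendsto_uniform_limitI[OF lim that] .
  have unique: "a = b" if "f \<longlonglongrightarrow> a" "f \<longlonglongrightarrow> b" for f :: "nat \<Rightarrow> real" and a b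
    using that by (rule LIMSEQ_unique)
  have M01: "M 0 = 0" "M 1 = 1"
    using ptlim[of 0] ptlim[of 1] by (auto simp: question_mark_iter_endpoints LIMSEQ_const_iff)
  have mono: "mono_on {0..1} M"
  proof (rule mono_onI)
    fix x y :: real assume "x \<in> {0..1}" "y \<in> {0..1}" "x \<le> y"
    then show "M x \<le> M y"
      by (intro LIMSEQ_le[OF ptlim ptlim]) (auto intro!: exI[of _ 0] mono_onD[OF question_mark_iter_mono])
  qed
  have inner: "M x = M (x / (1 - x)) / 2" if "x \<in> {0..1/2}" for x
  proof -
    have "(\<lambda>n. question_mark_iter (Suc n) x) \<longlonglongrightarrow> M x"
      using ptlim[of x] that by (subst filterlim_sequentially_Suc) auto
    moreover have "(\<lambda>n. question_mark_iter (Suc n) x) \<longlonglongrightarrow> M (x / (1 - x)) / 2"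
      using that ptlim[OF inner_branch_in_unit[of x]] by (auto intro!: tendsto_intros)
    ultimately show ?thesis by (rule unique)
  qed
  have outer: "M x = 1 - M ((1 - x) / x) / 2" if "x \<in> {1/2<..1}" for x
  proof -
    have "(\<lambda>n. question_mark_iter (Suc n) x) \<longlonglongrightarrow> M x"
      using ptlim[of x] that by (subst filterlim_sequentially_Suc) auto
    moreover have "(\<lambda>n. question_mark_iter (Suc n) x) \<longlonglongrightarrow> 1 - M ((1 - x) / x) / 2"
      using that ptlim[OF outer_branch_in_unit[of x]] by (auto intro!: tendsto_intros)
    ultimately show ?thesis by (rule unique)
  qed
  have halving: "M (x / (1 + x)) = M x / 2" if "x \<in> {0..1}" for x
  proof -
    have "x / (1 + x) / (1 - x / (1 + x)) = x" using that by (auto simp: field_simps)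
    moreover have "x / (1 + x) \<in> {0..1/2}" using that by (auto simp: field_simps)
    ultimately show ?thesis using inner[of "x / (1 + x)"] by simp
  qed
  have symm: "M (1 - x) = 1 - M x" if "x \<in> {0..1}" for x
  proof -
    consider "x < 1/2" | "x = 1/2" | "1/2 < x" by linarith
    then show ?thesis
    proof cases
      case 1
      then show ?thesis using inner[of x] outer[of "1 - x"] that by auto
    next
      case 2
      have "M (1/2) = 1/2" using inner[of "1/2"] M01 by simp
      then show ?thesis unfolding 2 by simp
    next
      case 3
      then show ?thesis using inner[of "1 - x"] outer[of x] that by auto
    qed
  qed
  show thesis by (rule that[OF cont mono M01 halving symm])
qed

section \<open>Self-similarity and density of the Farey sequences\<close>

text \<open>
The Moebius maps that carry the unit interval onto its two halves \<open>[0, 1/2]\<close> and \<open>[1/2, 1]\<close>.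
They are generic in the field because they act both on rationals, where mediants live, and on
reals.
\<close>

definition farey_left :: "'a::field \<Rightarrow> 'a" where
  "farey_left r = r / (1 + r)"

definition farey_right :: "'a::field \<Rightarrow> 'a" where
  "farey_right r = 1 / (2 - r)"

lemma farey_left_divide:
  fixes a b :: "'a::field"
  assumes "b \<noteq> 0" "a + b \<noteq> 0"
  shows "farey_left (a / b) = a / (a + b)"
  using assms by (simp add: farey_left_def field_simps)

lemma farey_right_divide:
  fixes a b :: "'a::field"
  assumes "b \<noteq> 0" "2 * b - a \<noteq> 0"
  shows "farey_right (a / b) = b / (2 * b - a)"
  using assms by (simp add: farey_right_def field_simps)

lemma of_rat_farey_left: "of_rat (farey_left r) = (farey_left (of_rat r) :: real)"
  by (simp add: farey_left_def of_rat_divide of_rat_add)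

lemma of_rat_farey_right: "of_rat (farey_right r) = (farey_right (of_rat r) :: real)"
  by (simp add: farey_right_def of_rat_divide of_rat_diff)

text \<open>
Mediants depend on lowest terms, so every computation with them starts from this representation.
\<close>

lemma quotient_of_unit_rat:
  assumes "r \<in> {0..1}"
  obtains p q where "quotient_of r = (p, q)" "r = of_int p / of_int q"
    "0 \<le> p" "p \<le> q" "0 < q" "coprime p q"
proof -
  obtain p q where pq: "quotient_of r = (p, q)" by (cases "quotient_of r")
  have r: "r = of_int p / of_int q" using quotient_of_div[OF pq] .
  have q: "0 < q" using quotient_of_denom_pos[OF pq] .
  have "0 \<le> p" "p \<le> q"
    using assms q unfolding r by (auto simp: field_simps zero_le_divide_iff)
  then show thesis using that pq r q quotient_of_coprime[OF pq] by blast
qed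

lemma quotient_of_reduced:
  assumes "coprime p q" "0 < q"
  shows "quotient_of (of_int p / of_int q) = (p, q)"
  using assms by (simp add: Fract_of_int_quotient[symmetric] quotient_of_Fract normalize_stable)

lemma mediant_reduced:
  assumes "coprime p1 q1" "0 < q1" "coprime p2 q2" "0 < q2"
  shows "mediant (of_int p1 / of_int q1) (of_int p2 / of_int q2)
    = of_int (p1 + p2) / of_int (q1 + q2)"
  using assms by (simp add: mediant_def quotient_of_reduced Fract_of_int_quotient)

lemma mediant_in_unit:
  assumes "s \<in> {0..1}" "t \<in> {0..1}"
  shows "mediant s t \<in> {0..1}"
proof -
  obtain p1 q1 where 1: "s = of_int p1 / of_int q1" "0 \<le> p1" "p1 \<le> q1" "0 < q1" "coprime p1 q1"
    using quotient_of_unit_rat[OF assms(1)] by metis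
  obtain p2 q2 where 2: "t = of_int p2 / of_int q2" "0 \<le> p2" "p2 \<le> q2" "0 < q2" "coprime p2 q2"
    using quotient_of_unit_rat[OF assms(2)] by metis
  have "mediant s t = of_int (p1 + p2) / of_int (q1 + q2)"
    unfolding 1(1) 2(1) using 1 2 by (intro mediant_reduced)
  moreover have "of_int (p1 + p2) / of_int (q1 + q2) \<in> {0..1::rat}"
  proof -
    have "0 \<le> rat_of_int (p1 + p2)" "rat_of_int (p1 + p2) \<le> of_int (q1 + q2)" "0 < rat_of_int (q1 + q2)"
      using 1 2 by (simp_all only: of_int_le_iff of_int_0_le_iff of_int_0_less_iff)
    then show ?thesis by (simp add: divide_le_eq_1)
  qed
  ultimately show ?thesis by simp
qed

lemma farey_left_reduced:
  assumes "coprime p q" "0 \<le> p" "0 < q"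
  shows "farey_left (of_int p / of_int q :: rat) = of_int p / of_int (p + q)" "coprime p (p + q)"
proof -
  have "0 < rat_of_int p + of_int q" using assms by (simp add: add_nonneg_pos)
  then show "farey_left (of_int p / of_int q :: rat) = of_int p / of_int (p + q)"
    using assms by (simp add: farey_left_divide)
  show "coprime p (p + q)" using assms by (simp add: coprime_iff_gcd_eq_1)
qed

lemma farey_right_reduced:
  assumes "coprime p q" "p \<le> q" "0 < q"
  shows "farey_right (of_int p / of_int q :: rat) = of_int q / of_int (2 * q - p)"
    "coprime q (2 * q - p)"
proof -
  have "of_int p < 2 * (of_int q :: rat)"
    using assms by (metis of_int_less_iff of_int_mult of_int_numeral mult_2 add_less_cancel_left
        add.right_neutral le_less_trans less_add_same_cancel2)
  then show "farey_right (of_int p / of_int q :: rat) = of_int q / of_int (2 * q - p)"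
    using assms by (simp add: farey_right_divide)
  have "gcd q (2 * q - p) = gcd q (- p + 2 * q)" by (simp add: algebra_simps)
  also have "\<dots> = gcd q (- p)" by (metis gcd_add_mult mult.commute add.commute)
  finally show "coprime q (2 * q - p)"
    using assms by (simp add: coprime_iff_gcd_eq_1 gcd.commute)
qed

text \<open>
The maps act on numerator-denominator pairs by the unimodular matrices \<open>(1 0; 1 1)\<close> and
\<open>(0 1; -1 2)\<close>. These preserve lowest terms and are additive, and mediants are sums of such pairs.
\<close>

lemma mediant_farey_left:
  assumes "s \<in> {0..1}" "t \<in> {0..1}"
  shows "mediant (farey_left s) (farey_left t) = farey_left (mediant s t)"
proof -
  obtain p1 q1 where 1: "s = of_int p1 / of_int q1" "0 \<le> p1" "p1 \<le> q1" "0 < q1" "coprime p1 q1"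
    using quotient_of_unit_rat[OF assms(1)] by metis
  obtain p2 q2 where 2: "t = of_int p2 / of_int q2" "0 \<le> p2" "p2 \<le> q2" "0 < q2" "coprime p2 q2"
    using quotient_of_unit_rat[OF assms(2)] by metis
  have "mediant (farey_left s) (farey_left t) = of_int (p1 + p2) / of_int ((p1 + q1) + (p2 + q2))"
    unfolding 1(1) 2(1) using 1 2 farey_left_reduced
    by (simp only: farey_left_reduced) (intro mediant_reduced, auto intro: farey_left_reduced(2))
  also have "\<dots> = farey_left (of_int (p1 + p2) / of_int (q1 + q2))"
  proof -
    have "0 < rat_of_int (q1 + q2)" "0 < rat_of_int ((p1 + q1) + (p2 + q2))"
      using 1 2 by (simp_all only: of_int_0_less_iff)
    then show ?thesis by (subst farey_left_divide) (simp_all add: algebra_simps)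
  qed
  also have "\<dots> = farey_left (mediant s t)"
    unfolding 1(1) 2(1) using 1 2 by (subst mediant_reduced) auto
  finally show ?thesis .
qed

lemma mediant_farey_right:
  assumes "s \<in> {0..1}" "t \<in> {0..1}"
  shows "mediant (farey_right s) (farey_right t) = farey_right (mediant s t)"
proof -
  obtain p1 q1 where 1: "s = of_int p1 / of_int q1" "0 \<le> p1" "p1 \<le> q1" "0 < q1" "coprime p1 q1"
    using quotient_of_unit_rat[OF assms(1)] by metis
  obtain p2 q2 where 2: "t = of_int p2 / of_int q2" "0 \<le> p2" "p2 \<le> q2" "0 < q2" "coprime p2 q2"
    using quotient_of_unit_rat[OF assms(2)] by metis
  have "mediant (farey_right s) (farey_right t)
      = of_int (q1 + q2) / of_int ((2 * q1 - p1) + (2 * q2 - p2))"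
    unfolding 1(1) 2(1) using 1 2 farey_right_reduced
    by (simp only: farey_right_reduced) (intro mediant_reduced, auto intro: farey_right_reduced(2))
  also have "\<dots> = farey_right (of_int (p1 + p2) / of_int (q1 + q2))"
  proof -
    have "0 < rat_of_int (q1 + q2)" "0 < rat_of_int ((2 * q1 - p1) + (2 * q2 - p2))"
      using 1 2 by (simp_all only: of_int_0_less_iff)
    then show ?thesis by (subst farey_right_divide) (simp_all add: algebra_simps)
  qed
  also have "\<dots> = farey_right (mediant s t)"
    unfolding 1(1) 2(1) using 1 2 by (subst mediant_reduced) auto
  finally show ?thesis .
qed

lemma insert_mediants_in_unit:
  assumes "set xs \<subseteq> {0..1}"
  shows "set (insert_mediants xs) \<subseteq> {0..1}"
  using assms
proof (induction xs rule: insert_mediants.induct)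
  case (1 s t xs)
  then show ?case using mediant_in_unit[of s t] by simp
qed auto

lemma insert_mediants_map:
  assumes "set xs \<subseteq> {0..1}"
    and "\<And>s t. s \<in> {0..1} \<Longrightarrow> t \<in> {0..1} \<Longrightarrow> mediant (f s) (f t) = f (mediant s t)"
  shows "insert_mediants (map f xs) = map f (insert_mediants xs)"
  using assms
  by (induction xs rule: insert_mediants.induct) auto

text \<open>
Insertion only looks at neighbouring entries, so a list may be cut at any entry provided that
this entry is kept on both sides.
\<close>

lemma insert_mediants_split:
  "insert_mediants (xs @ m # ys) = insert_mediants (xs @ [m]) @ tl (insert_mediants (m # ys))"
proof (induction xs rule: insert_mediants.induct)
  case ("2_1")
  then show ?case by (cases ys) auto
next
  case ("2_2" v)
  then show ?case by (cases ys) auto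
qed auto

lemma hd_insert_mediants: "xs \<noteq> [] \<Longrightarrow> insert_mediants xs = hd xs # tl (insert_mediants xs)"
  by (cases xs rule: insert_mediants.cases) auto

lemma last_insert_mediants:
  "xs \<noteq> [] \<Longrightarrow> insert_mediants xs \<noteq> [] \<and> last (insert_mediants xs) = last xs"
  by (induction xs rule: insert_mediants.induct) auto

lemma length_insert_mediants: "length (insert_mediants xs) = 2 * length xs - 1"
  by (induction xs rule: insert_mediants.induct) auto

lemma farey_Suc: "farey (Suc n) = insert_mediants (farey n)"
  by (simp add: farey_def)

lemma farey_in_unit: "set (farey n) \<subseteq> {0..1}"
  by (induction n) (simp_all add: farey_Suc insert_mediants_in_unit farey_def[of 0])

lemma farey_ends: "farey n \<noteq> [] \<and> farey n = 0 # tl (farey n) \<and> last (farey n) = 1"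
proof (induction n)
  case 0
  then show ?case by (simp add: farey_def)
next
  case (Suc n)
  then have "hd (farey n) = 0" by (metis list.sel(1))
  then show ?case using Suc hd_insert_mediants[of "farey n"] last_insert_mediants[of "farey n"]
    by (simp add: farey_Suc)
qed

lemma length_farey: "length (farey n) = 2 ^ n + 1"
  by (induction n) (simp_all add: farey_Suc length_insert_mediants farey_def[of 0])

lemma farey_nth_ends: "farey n ! 0 = 0" "farey n ! (2 ^ n) = 1"
proof -
  show "farey n ! 0 = 0" using farey_ends[of n] by (metis nth_Cons_0)
  have "last (farey n) = farey n ! (length (farey n) - 1)"
    using farey_ends[of n] by (intro last_conv_nth) auto
  then show "farey n ! (2 ^ n) = 1" using farey_ends[of n] by (simp only: length_farey) simp
qed

text \<open>
The two copies share the entry \<open>farey_left 1 = farey_right 0 = 1/2\<close>, which is why the head of the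
second one is dropped. Inserting mediants respects the cut at \<open>1/2\<close> and commutes with both maps.
\<close>

lemma farey_self_similar:
  "farey (Suc n) = map farey_left (farey n) @ tl (map farey_right (farey n))"
proof (induction n)
  case 0
  show ?case
    using mediant_reduced[of 0 1 1 1] by (simp add: farey_def farey_left_def farey_right_def)
next
  case (Suc n)
  let ?L = "map farey_left (farey n)" and ?R = "map farey_right (farey n)"
  have split_L: "?L = butlast ?L @ [1/2]"
    using farey_ends[of n] append_butlast_last_id[of ?L] by (simp add: last_map farey_left_def)
  have split_R: "?R = 1/2 # tl ?R"
    using farey_ends[of n] by (metis list.simps(9) list.sel(3) farey_right_def diff_zero)
  have maps: "insert_mediants ?L = map farey_left (insert_mediants (farey n))"
    "insert_mediants ?R = map farey_right (insert_mediants (farey n))"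
    by (intro insert_mediants_map farey_in_unit mediant_farey_left mediant_farey_right; assumption)+
  have "farey (Suc (Suc n)) = insert_mediants (?L @ tl ?R)"
    using Suc by (simp add: farey_Suc[of "Suc n"])
  also have "?L @ tl ?R = butlast ?L @ 1/2 # tl ?R"
    by (subst split_L) simp
  also have "insert_mediants \<dots> = insert_mediants ?L @ tl (insert_mediants ?R)"
    by (subst insert_mediants_split) (simp only: split_L[symmetric] split_R[symmetric])
  also have "\<dots> = map farey_left (farey (Suc n)) @ tl (map farey_right (farey (Suc n)))"
    using maps by (simp only: farey_Suc)
  finally show ?case .
qed

lemma farey_nth_left:
  assumes "k \<le> 2 ^ n"
  shows "farey (Suc n) ! k = farey_left (farey n ! k)"
  using assms by (simp add: farey_self_similar nth_append length_farey)

lemma farey_nth_right: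
  assumes "k \<le> 2 ^ n"
  shows "farey (Suc n) ! (2 ^ n + k) = farey_right (farey n ! k)"
proof (cases k)
  case 0
  \<comment> \<open>The shared entry \<open>1/2\<close> is stored as the last one of the left copy.\<close>
  then show ?thesis using farey_nth_left[of "2 ^ n" n]
    by (simp add: farey_left_def farey_right_def farey_nth_ends)
next
  case (Suc j)
  then show ?thesis using assms
    by (simp add: farey_self_similar nth_append length_farey nth_tl)
qed

lemma farey_nth_in_unit:
  assumes "k \<le> 2 ^ n"
  shows "real_of_rat (farey n ! k) \<in> {0..1}"
proof -
  have "farey n ! k \<in> {0..1}"
    using farey_in_unit[of n] assms nth_mem[of k "farey n"] unfolding length_farey
    by (metis Suc_eq_plus1 le_imp_less_Suc subsetD)
  then show ?thesis by (simp add: of_rat_le_1_iff zero_le_of_rat_iff)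
qed

text \<open>
A gap \<open>w\<close> is mapped to a gap of at most \<open>w / (1 + w)\<close>, and this map takes \<open>1 / (n + 1)\<close> to
\<open>1 / (n + 2)\<close>. Since \<open>farey_left\<close> has derivative \<open>1\<close> at \<open>0\<close>, no uniform contraction factor is
available.
\<close>

lemma farey_left_contracts:
  fixes u v :: real
  assumes "u \<in> {0..1}" "v \<in> {0..1}" "\<bar>u - v\<bar> \<le> 1 / (1 + real n)"
  shows "\<bar>farey_left u - farey_left v\<bar> \<le> 1 / (1 + real (Suc n))"
proof -
  have *: "farey_left y - farey_left x \<le> 1 / (1 + real (Suc n))"
    if "x \<le> y" "0 \<le> x" "y - x \<le> 1 / (1 + real n)" for x y :: real
  proof -
    define w where "w = y - x"
    have w: "0 \<le> w" "w * (1 + real n) \<le> 1" using that by (auto simp: w_def field_simps)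
    have "farey_left y - farey_left x = w / ((1 + x) * (1 + x + w))"
      using that by (auto simp: farey_left_def w_def field_simps)
    also have "\<dots> \<le> w / (1 * (1 + w))"
      using that w by (intro divide_left_mono mult_mono mult_pos_pos) auto
    also have "\<dots> \<le> 1 / (1 + real (Suc n))"
      using w by (auto simp: field_simps)
    finally show ?thesis .
  qed
  have mono: "farey_left x \<le> farey_left y" if "x \<le> y" "0 \<le> x" for x y :: real
    using that by (auto simp: farey_left_def field_simps)
  show ?thesis
    using *[of u v] *[of v u] mono[of u v] mono[of v u] assms by (cases "u \<le> v") auto
qed

lemma farey_right_conj: "farey_right x = 1 - farey_left (1 - x)" if "x \<noteq> 2" for x :: real
  using that by (simp add: farey_left_def farey_right_def field_simps)

text \<open>
The level \<open>n + 1\<close> approximation of \<open>x\<close> is the image of the level \<open>n\<close> approximation of the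
preimage of \<open>x\<close> under whichever of the two maps hits \<open>x\<close>.
\<close>

lemma farey_dense:
  fixes x :: real
  assumes "x \<in> {0..1}"
  shows "\<exists>k\<le>2 ^ n. \<bar>of_rat (farey n ! k) - x\<bar> \<le> 1 / (1 + real n)"
  using assms
proof (induction n arbitrary: x)
  case 0
  then show ?case by (auto intro!: exI[of _ 0] simp: farey_def)
next
  case (Suc n)
  show ?case
  proof (cases "x \<le> 1/2")
    case True
    define y where "y = x / (1 - x)"
    have y: "y \<in> {0..1}" "farey_left y = x"
      using True Suc.prems by (auto simp: y_def farey_left_def field_simps)
    obtain k where k: "k \<le> 2 ^ n" "\<bar>of_rat (farey n ! k) - y\<bar> \<le> 1 / (1 + real n)"
      using Suc.IH[OF y(1)] by blast
    have "\<bar>of_rat (farey (Suc n) ! k) - x\<bar> \<le> 1 / (1 + real (Suc n))"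
      using farey_left_contracts[OF farey_nth_in_unit[OF k(1)] y(1) k(2)]
      by (simp add: farey_nth_left[OF k(1)] of_rat_farey_left y(2))
    then show ?thesis using k(1) by (intro exI[of _ k]) auto
  next
    case False
    define y where "y = 2 - 1 / x"
    have y: "y \<in> {0..1}" "farey_right y = x"
      using False Suc.prems by (auto simp: y_def farey_right_def field_simps)
    obtain k where k: "k \<le> 2 ^ n" "\<bar>of_rat (farey n ! k) - y\<bar> \<le> 1 / (1 + real n)"
      using Suc.IH[OF y(1)] by blast
    let ?r = "real_of_rat (farey n ! k)"
    have r: "?r \<in> {0..1}" by (rule farey_nth_in_unit[OF k(1)])
    have "?r \<noteq> 2" "y \<noteq> 2" using r y(1) unfolding atLeastAtMost_iff by linarith+
    note conj = this[THEN farey_right_conj]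
    have "\<bar>farey_left (1 - ?r) - farey_left (1 - y)\<bar> \<le> 1 / (1 + real (Suc n))"
      using r y(1) k(2) by (intro farey_left_contracts) auto
    then have "\<bar>farey_right ?r - farey_right y\<bar> \<le> 1 / (1 + real (Suc n))"
      by (simp only: conj)
    then have "\<bar>of_rat (farey (Suc n) ! (2 ^ n + k)) - x\<bar> \<le> 1 / (1 + real (Suc n))"
      by (simp add: farey_nth_right[OF k(1)] of_rat_farey_right y(2))
    then show ?thesis using k(1) by (intro exI[of _ "2 ^ n + k"]) auto
  qed
qed

section \<open>The Minkowski function\<close>

text \<open>
The functional equations say that \<open>M\<close> turns \<open>farey_left\<close> and \<open>farey_right\<close> into the maps
\<open>y / 2\<close> and \<open>(1 + y) / 2\<close>, which generate the dyadic rationals in the same way as the former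
generate the Farey sequences.
\<close>

lemma question_mark_farey:
  fixes M :: "real \<Rightarrow> real"
  assumes "M 0 = 0" "M 1 = 1"
    and halving: "\<And>x. x \<in> {0..1} \<Longrightarrow> M (x / (1 + x)) = M x / 2"
    and symmetric: "\<And>x. x \<in> {0..1} \<Longrightarrow> M (1 - x) = 1 - M x"
    and "k \<le> 2 ^ n"
  shows "M (of_rat (farey n ! k)) = real k / 2 ^ n"
  using assms(5)
proof (induction n arbitrary: k)
  case 0
  then have "k = 0 \<or> k = 1" by auto
  then show ?case using assms(1,2) by (auto simp: farey_def)
next
  case (Suc n)
  show ?case
  proof (cases "k \<le> 2 ^ n")
    case True
    then show ?thesis
      using halving[OF farey_nth_in_unit[OF True], folded farey_left_def] Suc.IH[OF True]
      by (simp add: farey_nth_left of_rat_farey_left)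
  next
    case False
    define j where "j = k - 2 ^ n"
    have k: "k = 2 ^ n + j" and j: "j \<le> 2 ^ n" using False Suc.prems by (auto simp: j_def)
    define r where "r = real_of_rat (farey n ! j)"
    have r: "r \<in> {0..1}" unfolding r_def by (rule farey_nth_in_unit[OF j])
    then have "1 - r \<in> {0..1}" "farey_left (1 - r) \<in> {0..1}" "r \<noteq> 2"
      by (auto simp: farey_left_def field_simps)
    then have "M (farey_right r) = 1 - (1 - M r) / 2"
      using symmetric[of "farey_left (1 - r)"] halving[of "1 - r"] symmetric[of r] r
      by (simp add: farey_right_conj farey_left_def)
    moreover have "real_of_rat (farey (Suc n) ! k) = farey_right r"
      unfolding k farey_nth_right[OF j] of_rat_farey_right r_def ..
    ultimately show ?thesis
      unfolding k using Suc.IH[OF j] by (simp add: r_def field_simps)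
  qed
qed

lemma continuous_eq_if_eq_on_farey:
  fixes f g :: "real \<Rightarrow> real"
  assumes cont: "continuous_on {0..1} f" "continuous_on {0..1} g"
    and eq: "\<And>n k. k \<le> 2 ^ n \<Longrightarrow> f (of_rat (farey n ! k)) = g (of_rat (farey n ! k))"
    and x: "x \<in> {0..1}"
  shows "f x = g x"
proof -
  obtain k where k: "\<And>n. k n \<le> 2 ^ n" "\<And>n. \<bar>of_rat (farey n ! k n) - x\<bar> \<le> 1 / (1 + real n)"
    using farey_dense[OF x] by metis
  define r where "r n = real_of_rat (farey n ! k n)" for n
  have "(\<lambda>n. r n - x) \<longlonglongrightarrow> 0"
  proof (rule Lim_null_comparison)
    show "\<forall>\<^sub>F n in sequentially. norm (r n - x) \<le> 1 / (1 + real n)"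
      using k(2) by (simp add: r_def)
    show "(\<lambda>n. 1 / (1 + real n)) \<longlonglongrightarrow> 0"
      using LIMSEQ_inverse_real_of_nat by (simp add: inverse_eq_divide)
  qed
  then have r: "r \<longlonglongrightarrow> x" by (simp add: LIM_zero_iff)
  have r01: "r n \<in> {0..1}" for n unfolding r_def by (rule farey_nth_in_unit[OF k(1)])
  have "(\<lambda>n. f (r n)) \<longlonglongrightarrow> f x" "(\<lambda>n. g (r n)) \<longlonglongrightarrow> g x"
    using continuous_on_tendsto_compose[OF cont(1) r x] continuous_on_tendsto_compose[OF cont(2) r x] r01
    by auto
  moreover have "f (r n) = g (r n)" for n unfolding r_def by (rule eq[OF k(1)])
  ultimately show ?thesis by (simp add: LIMSEQ_unique)
qed

text \<open>
The solution of the functional equations, cut down to the unit interval, has the defining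
properties of the Minkowski function. Any function with these properties agrees with it on the
Farey fractions, hence everywhere by density.
\<close>

lemma minkowski_characterisation:
  "continuous_on {0..1} minkowski" "mono_on {0..1} minkowski" "minkowski 0 = 0" "minkowski 1 = 1"
  "x \<in> {0..1} \<Longrightarrow> minkowski (x / (1 + x)) = minkowski x / 2"
  "x \<in> {0..1} \<Longrightarrow> minkowski (1 - x) = 1 - minkowski x"
proof -
  obtain M :: "real \<Rightarrow> real" where M: "continuous_on {0..1} M" "mono_on {0..1} M" "M 0 = 0" "M 1 = 1"
    "\<And>x. x \<in> {0..1} \<Longrightarrow> M (x / (1 + x)) = M x / 2"
    "\<And>x. x \<in> {0..1} \<Longrightarrow> M (1 - x) = 1 - M x"
    using question_mark_exists by metis
  define M' where "M' = restrict M {0..1}"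
  have M'_eq: "M' x = M x" if "x \<in> {0..1}" for x using that by (simp add: M'_def)
  have vals: "M' (of_rat (farey n ! k)) = real k / 2 ^ n" if "k \<le> 2 ^ n" for n k
    using question_mark_farey[OF M(3-6) that] M'_eq[OF farey_nth_in_unit[OF that]] by simp
  have cont: "continuous_on {0..1} M'"
    using M(1) by (rule continuous_on_eq) (simp add: M'_eq)
  have range: "M' ` {0..1} \<subseteq> {0..1}"
    using mono_onD[OF M(2), of 0] mono_onD[OF M(2), of _ 1] M(3,4) by (force simp: M'_eq)
  have "minkowski = M'"
    unfolding minkowski_def
  proof (rule the_equality)
    show "M' \<in> extensional {0..1} \<and> M' ` {0..1} \<subseteq> {0..1} \<and> continuous_on {0..1} M' \<and>
      (\<forall>n k. k \<le> 2 ^ n \<longrightarrow> M' (of_rat (farey n ! k)) = real k / 2 ^ n)"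
      using vals cont range by (simp add: M'_def)
  next
    fix f :: "real \<Rightarrow> real"
    assume f: "f \<in> extensional {0..1} \<and> f ` {0..1} \<subseteq> {0..1} \<and> continuous_on {0..1} f \<and>
      (\<forall>n k. k \<le> 2 ^ n \<longrightarrow> f (of_rat (farey n ! k)) = real k / 2 ^ n)"
    show "f = M'"
    proof (rule extensionalityI[of _ "{0..1}"])
      show "f x = M' x" if "x \<in> {0..1}" for x
        by (rule continuous_eq_if_eq_on_farey[OF _ cont _ that]) (use f vals in auto)
    qed (use f in \<open>auto simp: M'_def\<close>)
  qed
  then have eq: "minkowski x = M x" if "x \<in> {0..1}" for x using M'_eq that by simp
  show "continuous_on {0..1} minkowski"
    using M(1) by (rule continuous_on_eq) (simp add: eq)
  show "mono_on {0..1} minkowski"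
    using mono_onD[OF M(2)] by (intro mono_onI) (simp add: eq)
  show "minkowski 0 = 0" "minkowski 1 = 1" using M(3,4) by (simp_all add: eq)
  show "minkowski (x / (1 + x)) = minkowski x / 2" if x: "x \<in> {0..1}"
  proof -
    have "x / (1 + x) \<in> {0..1}" using x by (auto simp: field_simps)
    then show ?thesis using M(5)[OF x] x by (simp only: eq)
  qed
  show "minkowski (1 - x) = 1 - minkowski x" if x: "x \<in> {0..1}"
    using M(6)[OF x] x by (simp add: eq)
qed

lemma minkowski_in_unit: "x \<in> {0..1} \<Longrightarrow> minkowski x \<in> {0..1}"
  using mono_onD[OF minkowski_characterisation(2), of 0 x]
    mono_onD[OF minkowski_characterisation(2), of x 1] minkowski_characterisation(3,4)
  by auto

section \<open>The extended Minkowski function and its symmetries\<close>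

text \<open>
Three times the mass of all cells \<open>[k, k + 1)\<close> with \<open>k \<le> m\<close>.
\<close>

definition cell_weight_sum :: "int \<Rightarrow> real" where
  "cell_weight_sum m = (\<Sum>\<^sub>\<infinity>k\<in>{..m}. 1 / 2 ^ nat \<bar>k\<bar>)"

lemma cell_weight_has_sum_nonpos:
  "((\<lambda>k. 1 / 2 ^ nat \<bar>k\<bar>) has_sum (2 / 2 ^ i :: real)) {..- int i}"
proof -
  have bij: "bij_betw (\<lambda>j. - int i - int j) UNIV {..- int i}"
    by (rule bij_betwI[where g="\<lambda>k. nat (- int i - k)"]) auto
  have "(\<lambda>j. (1/2::real) ^ j * (1 / 2 ^ i)) sums (1 / (1 - 1/2) * (1 / 2 ^ i))"
    by (intro sums_mult2 geometric_sums) simp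
  then have "((\<lambda>j. (1/2::real) ^ j * (1 / 2 ^ i)) has_sum (2 / 2 ^ i)) UNIV"
    by (intro sums_nonneg_imp_has_sum) auto
  moreover have "(1/2::real) ^ j * (1 / 2 ^ i) = 1 / 2 ^ nat \<bar>- int i - int j\<bar>" for j
  proof -
    have "nat \<bar>- int i - int j\<bar> = j + i" by simp
    then show ?thesis by (simp add: power_add power_divide)
  qed
  ultimately show ?thesis
    using has_sum_reindex_bij_betw[OF bij, of "\<lambda>k. 1 / 2 ^ nat \<bar>k\<bar>" "2 / 2 ^ i :: real"] by simp
qed

lemma cell_weight_has_sum_nonneg:
  "((\<lambda>k. 1 / 2 ^ nat \<bar>k\<bar>) has_sum (3 - 1 / 2 ^ i :: real)) {..int i}"
proof (induction i)
  case 0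
  then show ?case using cell_weight_has_sum_nonpos[of 0] by simp
next
  case (Suc i)
  have "((\<lambda>k. 1 / 2 ^ nat \<bar>k\<bar>) has_sum (1 / 2 ^ nat \<bar>int (Suc i)\<bar> + (3 - 1 / 2 ^ i :: real)))
      (insert (int (Suc i)) {..int i})"
    by (rule has_sum_insert[OF _ Suc]) simp
  moreover have "insert (int (Suc i)) {..int i} = {..int (Suc i)}" by auto
  moreover have "nat \<bar>int (Suc i)\<bar> = Suc i" by simp
  moreover have "1 / 2 ^ Suc i + (3 - 1 / 2 ^ i) = (3 - 1 / 2 ^ Suc i :: real)" by (simp add: field_simps)
  ultimately show ?case by (simp only:)
qed

lemma cell_weight_sum_eq:
  "cell_weight_sum (- int i) = 2 / 2 ^ i" "cell_weight_sum (int i) = 3 - 1 / 2 ^ i"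
  unfolding cell_weight_sum_def
  by (rule infsumI, rule cell_weight_has_sum_nonpos cell_weight_has_sum_nonneg)+

lemma int_pos_or_nonpos_cases:
  obtains (nonpos) i where "m = - int i" | (pos) i where "m = int (Suc i)"
proof (cases "m \<le> 0")
  case True
  then show ?thesis using nonpos[of "nat (- m)"] by simp
next
  case False
  then show ?thesis using pos[of "nat (m - 1)"] by simp
qed

lemma cell_weight_sum_step: "cell_weight_sum m = cell_weight_sum (m - 1) + 1 / 2 ^ nat \<bar>m\<bar>"
proof (cases m rule: int_pos_or_nonpos_cases)
  case (nonpos i)
  have "m - 1 = - int (Suc i)" "nat \<bar>m\<bar> = i" using nonpos by simp_all
  then show ?thesis unfolding nonpos by (simp only: cell_weight_sum_eq(1)) simp
next
  case (pos i)
  have "m - 1 = int i" "nat \<bar>m\<bar> = Suc i" using pos by simp_all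
  then show ?thesis unfolding pos
    using cell_weight_sum_eq(2)[of i] cell_weight_sum_eq(2)[of "Suc i"] by (simp add: field_simps)
qed

lemma cell_weight_sum_reflect: "cell_weight_sum (- m - 1) + cell_weight_sum m = 3"
proof (cases m rule: int_pos_or_nonpos_cases)
  case (nonpos i)
  have "- m - 1 = int i - 1" using nonpos by simp
  then show ?thesis
    using nonpos cell_weight_sum_eq(1)[of i] cell_weight_sum_eq(2)[of i] cell_weight_sum_step[of "int i"]
    by simp
next
  case (pos i)
  have "- m - 1 = - int (Suc (Suc i))" using pos by simp
  then show ?thesis
    using pos cell_weight_sum_eq(1)[of "Suc (Suc i)"] cell_weight_sum_eq(2)[of "Suc i"] by simp
qed

lemma cell_weight_sum_half: 
  assumes "m \<le> 0"
  shows "cell_weight_sum (m - 1) = cell_weight_sum m / 2"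
  using assms cell_weight_sum_eq(1)[of "nat (- m)"] cell_weight_sum_eq(1)[of "Suc (nat (- m))"]
  by simp

lemma cell_weight_sum_mono: "m \<le> n \<Longrightarrow> cell_weight_sum m \<le> cell_weight_sum n"
proof (induction n rule: int_ge_induct)
  case (step n)
  have "cell_weight_sum n \<le> cell_weight_sum (n + 1)"
    unfolding cell_weight_sum_step[of "n + 1"] by simp
  then show ?case using step.IH by linarith
qed simp

text \<open>
The right end point is included: there the fractional part jumps to \<open>0\<close>, and the loss is made up
by the weight that the sum gains. This overlap of the formulas gives continuity at the integers.
\<close>

lemma minkowski_ext_on_cell:
  assumes "of_int n \<le> q" "q \<le> of_int n + 1"
  shows "minkowski_ext q = (cell_weight_sum (n - 1) + minkowski (q - of_int n) / 2 ^ nat \<bar>n\<bar>) / 3"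
proof (cases "q = of_int n + 1")
  case True
  then have "\<lfloor>q\<rfloor> = n + 1" "frac q = 0" by (simp_all add: frac_def)
  then show ?thesis
    using cell_weight_sum_step[of n] True
    by (simp add: minkowski_ext_def minkowski_characterisation(3,4) cell_weight_sum_def[symmetric])
next
  case False
  then have "\<lfloor>q\<rfloor> = n" using assms by (intro floor_unique) auto
  then show ?thesis
    by (simp add: minkowski_ext_def frac_def cell_weight_sum_def[symmetric])
qed

lemma minkowski_ext_unit:
  assumes "t \<in> {0..1}"
  shows "minkowski_ext t = (1 + minkowski t) / 3"
  using minkowski_ext_on_cell[of 0 t] assms cell_weight_sum_eq(1)[of 1] by simp

lemma minkowski_ext_values: "minkowski_ext 0 = 1/3" "minkowski_ext (1/2) = 1/2" "minkowski_ext 1 = 2/3"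
  using minkowski_characterisation(5)[of 1]
  by (simp_all add: minkowski_ext_unit minkowski_characterisation(3,4))

lemma minkowski_ext_reflect: "minkowski_ext (1 - t) = 1 - minkowski_ext t"
proof -
  define n where "n = \<lfloor>t\<rfloor>"
  have n: "of_int n \<le> t" "t \<le> of_int n + 1" unfolding n_def by linarith+
  have "minkowski_ext (1 - t)
      = (cell_weight_sum (- n - 1) + minkowski (1 - (t - of_int n)) / 2 ^ nat \<bar>n\<bar>) / 3"
    using minkowski_ext_on_cell[of "- n" "1 - t"] n by (simp add: algebra_simps)
  also have "minkowski (1 - (t - of_int n)) = 1 - minkowski (t - of_int n)"
    using n by (intro minkowski_characterisation(6)) auto
  finally show ?thesis
    using minkowski_ext_on_cell[OF n] cell_weight_sum_reflect[of n] cell_weight_sum_step[of n]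
    by (simp add: diff_divide_distrib)
qed

text \<open>
On the cells \<open>[n, n + 1)\<close> with \<open>n \<le> 0\<close>, shifting one step to the left doubles every denominator.
The last such cell ends at \<open>1\<close>, which is the bound on \<open>t\<close>.
\<close>

lemma minkowski_ext_shift_left:
  assumes "t \<le> 1"
  shows "minkowski_ext (t - 1) = minkowski_ext t / 2"
proof -
  define n where "n = \<lceil>t\<rceil> - 1"
  have n: "of_int n \<le> t" "t \<le> of_int n + 1" unfolding n_def by linarith+
  have "n \<le> 0" using assms unfolding n_def by linarith
  then have *: "cell_weight_sum (n - 1 - 1) = cell_weight_sum (n - 1) / 2"
      "nat \<bar>n - 1\<bar> = Suc (nat \<bar>n\<bar>)"
    using cell_weight_sum_half[of "n - 1"] by auto
  have "minkowski_ext (t - 1)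
      = (cell_weight_sum (n - 1 - 1) + minkowski (t - of_int n) / 2 ^ nat \<bar>n - 1\<bar>) / 3"
    using minkowski_ext_on_cell[of "n - 1" "t - 1"] n by simp
  then show ?thesis
    unfolding * using minkowski_ext_on_cell[OF n] by (simp add: add_divide_distrib)
qed

lemma minkowski_ext_shift_right:
  assumes "0 \<le> t"
  shows "minkowski_ext (t + 1) = (1 + minkowski_ext t) / 2"
  using minkowski_ext_shift_left[of "1 - t"] minkowski_ext_reflect[of t]
    minkowski_ext_reflect[of "t + 1"] assms by simp

text \<open>
The order three rotation \<open>t \<mapsto> 1 - 1/t\<close> moves the arc \<open>(1, \<infinity>)\<close> to \<open>(0, 1)\<close>. The proof is by
induction on the cell of \<open>t\<close>: shifting \<open>t\<close> by one on the arc \<open>(1, \<infinity>)\<close> corresponds to one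
application of \<open>farey_right\<close> on \<open>(0, 1)\<close>.
\<close>

lemma minkowski_ext_rotate_aux:
  assumes "1 \<le> t" "t \<le> real n + 2"
  shows "minkowski_ext (1 - 1 / t) = minkowski_ext t - 1/3"
  using assms
proof (induction n arbitrary: t)
  case 0
  define s where "s = t - 1"
  have s: "s \<in> {0..1}" "s / (1 + s) \<in> {0..1}" and t: "t = s + 1"
    using 0 by (auto simp: s_def field_simps)
  have "1 - 1 / t = s / (1 + s)" using s by (auto simp: t field_simps)
  then show ?case
    using s minkowski_characterisation(5)[OF s(1)] minkowski_ext_shift_right[of s]
    by (simp add: t minkowski_ext_unit field_simps)
next
  case (Suc n)
  show ?case
  proof (cases "t \<le> real n + 2")
    case True
    then show ?thesis using Suc by simp
  next
    case False
    \<comment> \<open>In these terms \<open>1 - 1 / t = farey_right (1 - z)\<close> and \<open>1 - z\<close> is the rotation of \<open>t - 1\<close>.\<close>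
    define z where "z = 1 / (t - 1)"
    define w where "w = 1 / t"
    have z: "z \<in> {0..1}" and w: "w \<in> {0..1}" and zw: "w = z / (1 + z)"
      using False Suc.prems by (auto simp: z_def w_def field_simps)
    have unit: "minkowski_ext (1 - x) = (2 - minkowski x) / 3" if "x \<in> {0..1}" for x
      using minkowski_ext_unit[of "1 - x"] minkowski_characterisation(6)[OF that] that by simp
    have "minkowski w = minkowski z / 2"
      unfolding zw by (rule minkowski_characterisation(5)[OF z])
    then have "minkowski_ext (1 - 1 / t) = minkowski_ext (1 - z) / 2 + 1/3"
      unfolding w_def[symmetric] unit[OF z] unit[OF w] by simp
    moreover have "minkowski_ext (1 - z) = minkowski_ext (t - 1) - 1/3"
      unfolding z_def using Suc.prems False by (intro Suc.IH) auto
    moreover have "minkowski_ext t = (1 + minkowski_ext (t - 1)) / 2"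
      using minkowski_ext_shift_right[of "t - 1"] False by simp
    ultimately show ?thesis by (simp add: field_simps)
  qed
qed

lemma minkowski_ext_rotate_outer:
  assumes "1 \<le> t"
  shows "minkowski_ext (1 - 1 / t) = minkowski_ext t - 1/3"
proof -
  obtain n :: nat where "t \<le> real n" using real_arch_simple by blast
  then show ?thesis using minkowski_ext_rotate_aux[OF assms, of n] by simp
qed

text \<open>
For \<open>t \<ge> 1\<close> the inversion is the rotation followed by a shift. For \<open>t < 1\<close> the reflection in
\<open>1/2\<close> brings \<open>1/t\<close> back to the first case.
\<close>

lemma minkowski_ext_inversion:
  assumes "0 < t"
  shows "minkowski_ext (- 1 / t) = (minkowski_ext t - 1/3) / 2"
proof (cases "1 \<le> t")
  case True
  then show ?thesis
    using minkowski_ext_rotate_outer[OF True] minkowski_ext_shift_left[of "1 - 1 / t"] assms by simp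
next
  case False
  then have u: "1 \<le> 1 / t" "1 - 1 / t \<le> 1" "1 - 1 / (1 / t) = 1 - t" using assms by auto
  have "minkowski_ext (- 1 / t) = minkowski_ext (1 - 1 / t) / 2"
    using minkowski_ext_shift_left[OF u(2)] by simp
  also have "\<dots> = (1 - minkowski_ext (1 / t)) / 2" by (simp add: minkowski_ext_reflect)
  also have "minkowski_ext (1 / t) = minkowski_ext (1 - t) + 1/3"
    using minkowski_ext_rotate_outer[OF u(1)] by (simp add: u(3))
  finally show ?thesis by (simp add: minkowski_ext_reflect)
qed

lemma minkowski_ext_rotate:
  assumes "0 < t"
  shows "minkowski_ext (1 - 1 / t) = minkowski_ext t - 1/3"
proof (cases "1 \<le> t")
  case True
  then show ?thesis by (rule minkowski_ext_rotate_outer)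
next
  case False
  then have "1 - 1 / t \<le> 1" using assms by simp
  then show ?thesis
    using minkowski_ext_shift_left[of "1 - 1 / t"] minkowski_ext_inversion[OF assms] by simp
qed

lemma minkowski_ext_mono: "mono minkowski_ext"
proof (rule monoI)
  have lower: "cell_weight_sum (\<lfloor>x\<rfloor> - 1) / 3 \<le> minkowski_ext x"
    and upper: "minkowski_ext x \<le> cell_weight_sum \<lfloor>x\<rfloor> / 3" for x
  proof -
    have x: "of_int \<lfloor>x\<rfloor> \<le> x" "x \<le> of_int \<lfloor>x\<rfloor> + 1" by linarith+
    have "minkowski (x - of_int \<lfloor>x\<rfloor>) \<in> {0..1}" 
      by (rule minkowski_in_unit) (use x in \<open>unfold atLeastAtMost_iff, linarith\<close>)
    then show "cell_weight_sum (\<lfloor>x\<rfloor> - 1) / 3 \<le> minkowski_ext x"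
      "minkowski_ext x \<le> cell_weight_sum \<lfloor>x\<rfloor> / 3"
      using minkowski_ext_on_cell[OF x] cell_weight_sum_step[of "\<lfloor>x\<rfloor>"]
      by (auto simp: divide_right_mono)
  qed
  fix x y :: real
  assume "x \<le> y"
  then consider "\<lfloor>x\<rfloor> = \<lfloor>y\<rfloor>" | "\<lfloor>x\<rfloor> \<le> \<lfloor>y\<rfloor> - 1" using floor_mono[of x y] by linarith
  then show "minkowski_ext x \<le> minkowski_ext y"
  proof cases
    case 1
    define n where "n = \<lfloor>x\<rfloor>"
    have n: "of_int n \<le> x" "x \<le> of_int n + 1" "of_int n \<le> y" "y \<le> of_int n + 1"
      using 1 unfolding n_def by linarith+
    have "minkowski (x - of_int n) \<le> minkowski (y - of_int n)"
      using n \<open>x \<le> y\<close> by (intro mono_onD[OF minkowski_characterisation(2)]) auto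
    then show ?thesis
      unfolding minkowski_ext_on_cell[OF n(1,2)] minkowski_ext_on_cell[OF n(3,4)]
      by (intro divide_right_mono add_left_mono) simp_all
  next
    case 2
    have "minkowski_ext x \<le> cell_weight_sum \<lfloor>x\<rfloor> / 3" by (rule upper)
    also have "\<dots> \<le> cell_weight_sum (\<lfloor>y\<rfloor> - 1) / 3" using cell_weight_sum_mono[OF 2] by simp
    also have "\<dots> \<le> minkowski_ext y" by (rule lower)
    finally show ?thesis .
  qed
qed

lemma minkowski_ext_continuous: "isCont minkowski_ext x"
proof -
  have cell: "continuous_on {of_int n..of_int n + 1} minkowski_ext" for n
  proof -
    have "continuous_on {of_int n..of_int n + 1}
        (\<lambda>q. (cell_weight_sum (n - 1) + minkowski (q - of_int n) / 2 ^ nat \<bar>n\<bar>) / 3)"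
      by (intro continuous_intros continuous_on_compose2[OF minkowski_characterisation(1)]) auto
    then show ?thesis
      by (rule continuous_on_eq) (use minkowski_ext_on_cell in auto)
  qed
  define n where "n = \<lceil>x\<rceil> - 1"
  have x: "of_int n < x" "x < of_int n + 2" unfolding n_def by linarith+
  have "continuous_on ({of_int n..of_int n + 1} \<union> {of_int (n + 1)..of_int (n + 1) + 1}) minkowski_ext"
    by (intro continuous_on_closed_Un cell) auto
  moreover have "{of_int n..of_int n + 1} \<union> {of_int (n + 1)..of_int (n + 1) + 1} = {of_int n..of_int n + 2::real}"
    by auto
  ultimately have "continuous_on {of_int n..of_int n + 2} minkowski_ext" by simp
  then show ?thesis by (rule continuous_on_interior) (use x in simp)
qed

text \<open>
By inversion the limit at minus infinity is the limit at \<open>0\<close> from the right, which continuity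
provides.
\<close>

lemma minkowski_ext_at_bot: "(minkowski_ext \<longlongrightarrow> 0) at_bot"
proof -
  have "((\<lambda>t. - 1 / t) \<longlongrightarrow> 0) (at_bot :: real filter)"
    by (intro tendsto_divide_0[OF tendsto_const]) (rule filterlim_mono[OF filterlim_ident at_bot_le_at_infinity order_refl])
  then have "((\<lambda>t. (minkowski_ext (- 1 / t) - 1/3) / 2) \<longlongrightarrow> (minkowski_ext 0 - 1/3) / 2) at_bot"
    by (intro tendsto_intros isCont_tendsto_compose[OF minkowski_ext_continuous]) simp_all
  moreover have "\<forall>\<^sub>F t in at_bot. (minkowski_ext (- 1 / t) - 1/3) / 2 = minkowski_ext t"
    using eventually_gt_at_bot[of 0]
  proof eventually_elim
    case (elim t)
    then show ?case using minkowski_ext_inversion[of "- 1 / t"] by simp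
  qed
  ultimately show ?thesis
    by (simp add: minkowski_ext_values filterlim_cong)
qed

lemma minkowski_ext_at_top: "(minkowski_ext \<longlongrightarrow> 1) at_top"
proof -
  have "filterlim (\<lambda>t. 1 - t) at_bot (at_top :: real filter)"
    using filterlim_compose[OF filterlim_uminus_at_bot_at_top
        filterlim_tendsto_add_at_top[OF tendsto_const filterlim_ident, of "- 1"]] by simp
  then have "((\<lambda>t. 1 - minkowski_ext (1 - t)) \<longlongrightarrow> 1 - 0) at_top"
    by (intro tendsto_intros filterlim_compose[OF minkowski_ext_at_bot])
  then show ?thesis by (simp add: minkowski_ext_reflect)
qed

section \<open>The Minkowski measure on the real line\<close>

lemma prob_measure_eqI_Ico:
  fixes M N :: "real measure"
  assumes "prob_space M" "prob_space N" and sets: "sets M = sets borel" "sets N = sets borel"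
    and eq: "\<And>s t. s < t \<Longrightarrow> measure M {s..<t} = measure N {s..<t}"
  shows "M = N"
proof -
  interpret M: prob_space M by fact
  interpret N: prob_space N by fact
  let ?E = "range (\<lambda>(a, b). {a..<b::real})"
  have borel: "sets borel = sigma_sets UNIV ?E"
    by (subst borel_eq_atLeastLessThan) simp
  show ?thesis
  proof (rule measure_eqI_generator_eq[where E = ?E and \<Omega> = UNIV and A = "\<lambda>i::nat. {- real i..<real i}"])
    show "Int_stable ?E"
    proof (rule Int_stableI_image)
      fix p q :: "real \<times> real"
      have "(case p of (a, b) \<Rightarrow> {a..<b}) \<inter> (case q of (a, b) \<Rightarrow> {a..<b})
          = (case (max (fst p) (fst q), min (snd p) (snd q)) of (a, b) \<Rightarrow> {a..<b})"
        by (auto split: prod.split)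
      then show "\<exists>r\<in>UNIV. (case p of (a, b) \<Rightarrow> {a..<b}) \<inter> (case q of (a, b) \<Rightarrow> {a..<b})
          = (case r of (a, b) \<Rightarrow> {a..<b})"
        by blast
    qed
    show "emeasure M X = emeasure N X" if X: "X \<in> ?E" for X
    proof -
      from X obtain p where "X = (\<lambda>(a, b). {a..<b}) p" by (rule rangeE)
      then obtain s t where "X = {s..<t}" by (cases p) auto
      then show ?thesis
        using eq[of s t] by (cases "s < t") (simp_all add: M.emeasure_eq_measure N.emeasure_eq_measure)
    qed
    show "(\<Union>i. {- real i..<real i}) = UNIV"
    proof (safe; simp)
      fix x :: real
      obtain i :: nat where "\<bar>x\<bar> < real i" using reals_Archimedean2 by blast
      then show "\<exists>i. - real i \<le> x \<and> x < real i" by (intro exI[of _ i]) auto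
    qed
    show "range (\<lambda>i. {- real i..<real i}) \<subseteq> ?E"
      by (rule image_subsetI, rule range_eqI[where x = "(- real i, real i)" for i]) simp
    show "sets M = sigma_sets UNIV ?E" "sets N = sigma_sets UNIV ?E"
      using sets borel by simp_all
    show "emeasure M {- real i..<real i} \<noteq> \<infinity>" for i
      by (simp add: M.emeasure_eq_measure)
  qed simp
qed

lemma real_distribution_interval_minkowski: "real_distribution (interval_measure minkowski_ext)"
  and cdf_interval_minkowski: "cdf (interval_measure minkowski_ext) = minkowski_ext"
proof -
  note mono = monoD[OF minkowski_ext_mono]
  have right_cont: "continuous (at_right a) minkowski_ext" for a
    by (rule continuous_at_imp_continuous_at_within[OF minkowski_ext_continuous])
  show "real_distribution (interval_measure minkowski_ext)"
    by (rule real_distribution_interval_measure[OF mono right_cont minkowski_ext_at_bot minkowski_ext_at_top])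
  show "cdf (interval_measure minkowski_ext) = minkowski_ext"
    by (rule cdf_interval_measure[OF mono right_cont minkowski_ext_at_bot])
qed

lemma minkowski_measure_real_eq: "minkowski_measure_real = interval_measure minkowski_ext"
proof -
  let ?N = "interval_measure minkowski_ext"
  interpret N: real_distribution ?N by (rule real_distribution_interval_minkowski)
  have atom: "measure ?N {x} = 0" for x
    using N.isCont_cdf[of x] by (simp add: cdf_interval_minkowski minkowski_ext_continuous)
  have AE_neq: "AE x in ?N. x \<noteq> p" for p
    by (rule AE_I[where N = "{p}"]) (auto simp: N.emeasure_eq_measure atom)
  have Ico: "measure ?N {s..<t} = minkowski_ext t - minkowski_ext s" if "s < t" for s t
  proof -
    have "measure ?N {s..<t} = measure ?N {s<..t}"
    proof (rule N.finite_measure_eq_AE)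
      show "AE x in ?N. x \<in> {s..<t} \<longleftrightarrow> x \<in> {s<..t}"
        using AE_neq[of s] AE_neq[of t] by eventually_elim auto
    qed auto
    then show ?thesis using N.cdf_diff_eq[OF that] by (simp add: cdf_interval_minkowski)
  qed
  show ?thesis
    unfolding minkowski_measure_real_def
  proof (rule the_equality)
    show "prob_space ?N \<and> sets ?N = sets borel \<and>
      (\<forall>s t. s < t \<longrightarrow> measure ?N {s..<t} = minkowski_ext t - minkowski_ext s)"
      by (intro conjI allI impI N.prob_space_axioms N.events_eq_borel Ico)
  next
    fix M :: "real measure"
    assume M: "prob_space M \<and> sets M = sets borel \<and>
      (\<forall>s t. s < t \<longrightarrow> measure M {s..<t} = minkowski_ext t - minkowski_ext s)"
    show "M = ?N"
    proof (rule prob_measure_eqI_Ico)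
      show "measure M {s..<t} = measure ?N {s..<t}" if "s < t" for s t
        using M Ico[OF that] that by simp
    qed (use M N.prob_space_axioms in simp_all)
  qed
qed

interpretation minkowski: real_distribution minkowski_measure_real
  unfolding minkowski_measure_real_eq by (rule real_distribution_interval_minkowski)

lemma cdf_minkowski_measure_real: "cdf minkowski_measure_real = minkowski_ext"
  unfolding minkowski_measure_real_eq by (rule cdf_interval_minkowski)

lemma AE_minkowski_neq: "AE x in minkowski_measure_real. x \<noteq> p"
proof (rule AE_I[where N = "{p}"])
  show "emeasure minkowski_measure_real {p} = 0"
    using minkowski.isCont_cdf[of p]
    by (simp add: cdf_minkowski_measure_real minkowski_ext_continuous minkowski.emeasure_eq_measure)
qed (simp_all add: subset_eq)

lemma measure_minkowski_Iic: "measure minkowski_measure_real {..t} = minkowski_ext t"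
  using fun_cong[OF cdf_minkowski_measure_real, of t] by (simp add: cdf_def)

lemma measure_minkowski_Ioc:
  "s \<le> t \<Longrightarrow> measure minkowski_measure_real {s<..t} = minkowski_ext t - minkowski_ext s"
  using minkowski.cdf_diff_eq[of s t] unfolding cdf_minkowski_measure_real
  by (cases "s = t") simp_all

lemma measure_minkowski_Ioi: "measure minkowski_measure_real {s<..} = 1 - minkowski_ext s"
proof -
  have "measure minkowski_measure_real (space minkowski_measure_real - {..s}) = 1 - minkowski_ext s"
    by (subst minkowski.prob_compl) (simp_all add: measure_minkowski_Iic)
  moreover have "space minkowski_measure_real - {..s} = {s<..}" by auto
  ultimately show ?thesis by (simp only:)
qed

section \<open>Images of the measure under the generators\<close>

lemma neg_reciprocal_le_iff:
  fixes y s :: real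
  assumes "y \<noteq> 0"
  shows "s < 0 \<Longrightarrow> - 1 / y \<le> s \<longleftrightarrow> 0 < y \<and> y \<le> - 1 / s"
    and "- 1 / y \<le> 0 \<longleftrightarrow> 0 < y"
    and "0 < s \<Longrightarrow> - 1 / y \<le> s \<longleftrightarrow> 0 < y \<or> y \<le> - 1 / s"
proof -
  have y: "- 1 / y \<le> s \<longleftrightarrow> (if 0 < y then - 1 \<le> s * y else s * y \<le> - 1)"
    using assms pos_divide_le_eq[of y "- 1" s] neg_divide_le_eq[of y "- 1" s] by (cases "0 < y") auto
  show "- 1 / y \<le> s \<longleftrightarrow> 0 < y \<and> y \<le> - 1 / s" if s: "s < 0"
  proof -
    have "y \<le> - 1 / s \<longleftrightarrow> - 1 \<le> s * y"
      using neg_le_divide_eq[OF s, of y "- 1"] by (simp only: mult.commute)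
    moreover have "\<not> s * y \<le> - 1" if "\<not> 0 < y"
    proof -
      have "0 \<le> s * y" using s that by (intro mult_nonpos_nonpos) linarith+
      then show ?thesis by linarith
    qed
    ultimately show ?thesis unfolding y by (simp only: if_bool_eq_conj) blast
  qed
  show "- 1 / y \<le> s \<longleftrightarrow> 0 < y \<or> y \<le> - 1 / s" if s: "0 < s"
  proof -
    have "y \<le> - 1 / s \<longleftrightarrow> s * y \<le> - 1"
      using pos_le_divide_eq[OF s, of y "- 1"] by (simp only: mult.commute)
    moreover have "- 1 \<le> s * y" if "0 < y"
    proof -
      have "0 \<le> s * y" using s that by (intro mult_nonneg_nonneg) linarith+
      then show ?thesis by linarith
    qed
    ultimately show ?thesis unfolding y by (simp only: if_bool_eq_conj) blast
  qed
  show "- 1 / y \<le> 0 \<longleftrightarrow> 0 < y"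
    using assms by (cases "0 < y") (simp_all add: not_less)
qed

text \<open>
All three generators are of the form \<open>- 1 / (k x - d)\<close> with \<open>k > 0\<close>, up to an increasing affine
change of the value. The sublevel sets of such a map are intervals that begin at the pole \<open>p\<close>, or
complements of intervals that end there. The pole itself, where division yields \<open>0\<close>, is a null set.
\<close>

lemma measure_neg_reciprocal_le:
  fixes k d s :: real
  assumes "0 < k"
  defines "p \<equiv> d / k" and "e \<equiv> (d - 1 / s) / k"
  shows "measure minkowski_measure_real {x. - 1 / (k * x - d) \<le> s} =
    (if s < 0 then minkowski_ext e - minkowski_ext p
     else if s = 0 then 1 - minkowski_ext p
     else 1 - minkowski_ext p + minkowski_ext e)"
proof -
  let ?N = minkowski_measure_real
  let ?S = "if s < 0 then {p<..e} else if s = 0 then {p<..} else {p<..} \<union> {..e}"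
  have p: "p < x \<longleftrightarrow> 0 < k * x - d" and e: "x \<le> e \<longleftrightarrow> k * x - d \<le> - 1 / s" for x
    unfolding p_def e_def using assms(1) by (auto simp: field_simps)
  have "measure ?N {x. - 1 / (k * x - d) \<le> s} = measure ?N ?S"
  proof (rule minkowski.finite_measure_eq_AE)
    show "AE x in ?N. x \<in> {x. - 1 / (k * x - d) \<le> s} \<longleftrightarrow> x \<in> ?S"
      using AE_minkowski_neq[of p]
    proof eventually_elim
      case (elim x)
      define y where "y = k * x - d"
      have "y \<noteq> 0" using elim assms(1) by (auto simp: y_def p_def)
      note iff = neg_reciprocal_le_iff[OF this]
      have pe: "p < x \<longleftrightarrow> 0 < y" "x \<le> e \<longleftrightarrow> y \<le> - 1 / s" unfolding y_def by (rule p e)+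
      consider "s < 0" | "s = 0" | "0 < s" by linarith
      then show ?case
        unfolding mem_Collect_eq y_def[symmetric] by cases (simp_all only: iff, simp_all add: pe)
    qed
  qed auto
  moreover have "measure ?N {p<..e} = minkowski_ext e - minkowski_ext p" if "s < 0"
  proof (rule measure_minkowski_Ioc)
    have "1 / s \<le> 0" using that by simp
    then show "p \<le> e" unfolding p_def e_def using assms(1) by (intro divide_right_mono) linarith+
  qed
  moreover have "measure ?N ({p<..} \<union> {..e}) = 1 - minkowski_ext p + minkowski_ext e" if "0 < s"
  proof -
    have "0 < 1 / s" using that by simp
    then have "e < p" unfolding p_def e_def using assms(1) by (intro divide_strict_right_mono) linarith+
    then have "{p<..} \<inter> {..e} = {}" by auto
    then have "measure ?N ({p<..} \<union> {..e}) = measure ?N {p<..} + measure ?N {..e}"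
      by (intro minkowski.finite_measure_Union) simp_all
    then show ?thesis by (simp only: measure_minkowski_Ioi measure_minkowski_Iic)
  qed
  ultimately show ?thesis
    using measure_minkowski_Ioi[of p] by (cases "s < 0"; cases "s = 0") simp_all
qed

lemma measure_minkowski_b_le:
  "measure minkowski_measure_real {x. - 1 / x \<le> t}
    = (if t \<le> 0 then 2 * minkowski_ext t else (1 + minkowski_ext t) / 2)"
proof -
  consider "t < 0" | "t = 0" | "0 < t" by linarith
  then show ?thesis
  proof cases
    case 1
    define u where "u = - 1 / t"
    have "0 < u" "- 1 / u = t" "(0 - 1 / t) / 1 = u" using 1 by (simp_all add: u_def)
    then show ?thesis
      using measure_neg_reciprocal_le[of 1 0 t] minkowski_ext_inversion[of u] 1
      by (simp add: minkowski_ext_values)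
  next
    case 2
    then show ?thesis
      using measure_neg_reciprocal_le[of 1 0 0] by (simp add: minkowski_ext_values)
  next
    case 3
    then show ?thesis
      using measure_neg_reciprocal_le[of 1 0 t] minkowski_ext_inversion[of t]
      by (simp add: minkowski_ext_values add_divide_distrib)
  qed
qed

text \<open>
As \<open>t\<close> grows, the right-hand side increases at half the rate of \<open>minkowski_ext\<close> up to \<open>1\<close> and at
twice its rate afterwards: the image under \<open>a\<close> has density \<open>2\<close> on the arc \<open>(1, \<infinity>)\<close> that its side
cuts off. The corresponding arcs are \<open>(-\<infinity>, 0)\<close> for \<open>b\<close> and \<open>(0, 1)\<close> for \<open>c\<close>.
\<close>

lemma measure_minkowski_a_le:
  "measure minkowski_measure_real {x. (x - 2) / (x - 1) \<le> t}
    = (if t \<le> 1 then minkowski_ext t / 2 else 2 * minkowski_ext t - 1)"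
proof -
  have "measure minkowski_measure_real {x. (x - 2) / (x - 1) \<le> t}
      = measure minkowski_measure_real {x. - 1 / (1 * x - 1) \<le> t - 1}"
  proof (rule minkowski.finite_measure_eq_AE)
    show "AE x in minkowski_measure_real. x \<in> {x. (x - 2) / (x - 1) \<le> t} \<longleftrightarrow>
        x \<in> {x. - 1 / (1 * x - 1) \<le> t - 1}"
      using AE_minkowski_neq[of 1]
    proof eventually_elim
      case (elim x)
      then have "(x - 2) / (x - 1) = 1 + - 1 / (1 * x - 1)" by (simp add: field_simps)
      then show ?case by auto
    qed
  qed auto
  also have "\<dots> = (if t \<le> 1 then minkowski_ext t / 2 else 2 * minkowski_ext t - 1)"
  proof -
    consider "t < 1" | "t = 1" | "1 < t" by linarith
    then show ?thesis
    proof cases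
      case 1
      define s where "s = 1 / (1 - t)"
      have s: "0 < s" "1 - 1 / s = t" "1 - 1 / (t - 1) = s + 1"
        using 1 by (auto simp: s_def field_simps)
      show ?thesis
        using measure_neg_reciprocal_le[of 1 1 "t - 1"] 1 minkowski_ext_rotate[OF s(1)]
          minkowski_ext_shift_right[of s] s
        by (simp add: minkowski_ext_values add_divide_distrib)
    next
      case 2
      then show ?thesis
        using measure_neg_reciprocal_le[of 1 1 0] by (simp add: minkowski_ext_values)
    next
      case 3
      then show ?thesis
        using measure_neg_reciprocal_le[of 1 1 "t - 1"] minkowski_ext_rotate[of "t - 1"]
          minkowski_ext_shift_right[of "t - 1"]
        by (simp add: minkowski_ext_values)
    qed
  qed
  finally show ?thesis .
qed

text \<open>
With \<open>u\<close> the image of \<open>x\<close> under \<open>c\<close> and \<open>w = x / (1 - x)\<close>, the rotation takes \<open>u\<close> to \<open>w\<close> and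
\<open>w + 1\<close> to \<open>x\<close>, so the claim combines two rotations with one shift.
\<close>

lemma minkowski_ext_c_left:
  assumes "0 \<le> x" "x < 1/2"
  shows "minkowski_ext ((x - 1) / (2 * x - 1)) = 2 * minkowski_ext x"
proof -
  define w where "w = x / (1 - x)"
  define u where "u = (x - 1) / (2 * x - 1)"
  have "w + 1 = 1 / (1 - x)" using assms by (simp add: w_def field_simps)
  then have w: "0 \<le> w" "1 - 1 / (w + 1) = x" using assms by (simp_all add: w_def)
  have u: "0 < u" using assms by (auto simp: u_def zero_less_divide_iff)
  have "1 - 1 / u = 1 - (2 * x - 1) / (x - 1)" by (simp add: u_def)
  also have "\<dots> = w" using assms by (simp add: w_def field_simps)
  finally have uw: "1 - 1 / u = w" .
  have "minkowski_ext x = minkowski_ext (w + 1) - 1/3"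
    using minkowski_ext_rotate[of "w + 1"] w by simp
  also have "minkowski_ext (w + 1) = (1 + minkowski_ext w) / 2"
    by (rule minkowski_ext_shift_right[OF w(1)])
  also have "minkowski_ext w = minkowski_ext u - 1/3"
    using minkowski_ext_rotate[OF u] uw by simp
  finally show ?thesis by (simp add: u_def field_simps)
qed

lemma minkowski_ext_c_right:
  assumes "1/2 < x" "x \<le> 1"
  shows "minkowski_ext ((x - 1) / (2 * x - 1)) = 2 * minkowski_ext x - 1"
proof -
  have "(x - 1) / (2 * x - 1) = 1 - ((1 - x) - 1) / (2 * (1 - x) - 1)"
    using assms by (simp add: field_simps)
  then show ?thesis
    using minkowski_ext_c_left[of "1 - x"] assms by (simp only: minkowski_ext_reflect) simp
qed

text \<open>
Outside \<open>[0, 1]\<close> the value at \<open>t\<close> comes from that at the image \<open>u\<close> of \<open>t\<close>, which lies inside,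
because \<open>c\<close> is an involution.
\<close>

lemma measure_minkowski_c_le:
  "measure minkowski_measure_real {x. (x - 1) / (2 * x - 1) \<le> t}
    = (if t < 0 then minkowski_ext t / 2
       else if t \<le> 1 then 2 * minkowski_ext t - 1/2
       else (1 + minkowski_ext t) / 2)"
proof -
  define u where "u = (t - 1) / (2 * t - 1)"
  have e: "(1 - 1 / (2 * t - 1)) / 2 = u" if "t \<noteq> 1/2"
    using that by (simp add: u_def field_simps)
  have "measure minkowski_measure_real {x. (x - 1) / (2 * x - 1) \<le> t}
      = measure minkowski_measure_real {x. - 1 / (2 * x - 1) \<le> 2 * t - 1}"
  proof (rule minkowski.finite_measure_eq_AE)
    show "AE x in minkowski_measure_real. x \<in> {x. (x - 1) / (2 * x - 1) \<le> t} \<longleftrightarrow>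
        x \<in> {x. - 1 / (2 * x - 1) \<le> 2 * t - 1}"
      using AE_minkowski_neq[of "1/2"]
    proof eventually_elim
      case (elim x)
      define y where "y = - 1 / (2 * x - 1)"
      have "(x - 1) / (2 * x - 1) = (1 + y) / 2" using elim by (simp add: y_def field_simps)
      moreover have "z \<le> t \<longleftrightarrow> y \<le> 2 * t - 1" if "z = (1 + y) / 2" for z using that by auto
      ultimately show ?case unfolding mem_Collect_eq y_def[symmetric] by blast
    qed
  qed auto
  also have "\<dots> = (if t < 1/2 then minkowski_ext u - 1/2
      else if t = 1/2 then 1/2 else 1/2 + minkowski_ext u)"
    using measure_neg_reciprocal_le[of 2 1 "2 * t - 1"] e by (auto simp: minkowski_ext_values)
  also have "\<dots> = (if t < 0 then minkowski_ext t / 2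
       else if t \<le> 1 then 2 * minkowski_ext t - 1/2
       else (1 + minkowski_ext t) / 2)"
  proof -
    have invol: "(u - 1) / (2 * u - 1) = t" if "t \<noteq> 1/2"
    proof -
      have "u - 1 = - t / (2 * t - 1)" "2 * u - 1 = - 1 / (2 * t - 1)"
        using that by (simp_all add: u_def field_simps)
      then show ?thesis using that by simp
    qed
    consider "t < 0" | "0 \<le> t" "t < 1/2" | "t = 1/2" | "1/2 < t" "t \<le> 1" | "1 < t" by linarith
    then show ?thesis
    proof cases
      case 1
      then have "1/2 < u" "u \<le> 1" by (auto simp: u_def field_simps)
      then show ?thesis using minkowski_ext_c_right[of u] invol 1 by simp
    next
      case 2
      then show ?thesis using minkowski_ext_c_left[of t] by (simp add: u_def)
    next
      case 3
      show ?thesis unfolding 3 by (simp add: minkowski_ext_values)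
    next
      case 4
      then show ?thesis using minkowski_ext_c_right[of t] by (simp add: u_def)
    next
      case 5
      then have "0 \<le> u" "u < 1/2" by (auto simp: u_def field_simps)
      then show ?thesis using minkowski_ext_c_left[of u] invol 5 by simp
    qed
  qed
  finally show ?thesis .
qed

text \<open>
The right-hand side is integration against a probability measure \<open>K\<close>, namely the law of \<open>g i x\<close>
for a uniformly random index \<open>i\<close> and an independent point \<open>x\<close>. It therefore suffices to compare
distribution functions.
\<close>

lemma nn_integral_minkowski_stationary:
  fixes f :: "real \<Rightarrow> ennreal"
  assumes [measurable]: "f \<in> borel_measurable borel"
  defines "N \<equiv> minkowski_measure_real"
  shows "(\<integral>\<^sup>+x. f x \<partial>N) = ennreal (1/3) * ((\<integral>\<^sup>+x. f ((x - 2) / (x - 1)) \<partial>N)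
    + (\<integral>\<^sup>+x. f (- 1 / x) \<partial>N) + (\<integral>\<^sup>+x. f ((x - 1) / (2 * x - 1)) \<partial>N))"
proof -
  define U where "U = uniform_count_measure {0, 1, 2::nat}"
  define g :: "nat \<Rightarrow> real \<Rightarrow> real" where
    "g i x = (if i = 0 then (x - 2) / (x - 1) else if i = 1 then - 1 / x else (x - 1) / (2 * x - 1))"
    for i x
  define K where "K = distr (U \<Otimes>\<^sub>M N) borel (\<lambda>(i, x). g i x)"
  interpret U: prob_space U
    unfolding U_def by (rule prob_space_uniform_count_measure) auto
  interpret N: real_distribution N unfolding N_def by (rule minkowski.real_distribution_axioms)
  interpret UN: pair_prob_space U N ..
  have sets_U: "sets U = sets (count_space {0, 1, 2})"
    unfolding U_def by (rule sets_uniform_count_measure_count_space)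
  have g: "(\<lambda>(i, x). g i x) \<in> borel_measurable (U \<Otimes>\<^sub>M N)"
  proof -
    have "(\<lambda>(i, x). g i x) \<in> borel_measurable (count_space {0, 1, 2} \<Otimes>\<^sub>M N)"
      by (rule measurable_pair_measure_countable1) (auto simp: g_def)
    moreover have "borel_measurable (U \<Otimes>\<^sub>M N) = borel_measurable (count_space {0, 1, 2} \<Otimes>\<^sub>M N)"
      by (intro measurable_cong_sets sets_pair_measure_cong sets_U refl)
    ultimately show ?thesis by blast
  qed
  have K: "(\<integral>\<^sup>+x. h x \<partial>K) = ennreal (1/3) * ((\<integral>\<^sup>+x. h ((x - 2) / (x - 1)) \<partial>N)
    + (\<integral>\<^sup>+x. h (- 1 / x) \<partial>N) + (\<integral>\<^sup>+x. h ((x - 1) / (2 * x - 1)) \<partial>N))"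
    if [measurable]: "h \<in> borel_measurable borel" for h :: "real \<Rightarrow> ennreal"
  proof -
    have "(\<integral>\<^sup>+x. h x \<partial>K) = (\<integral>\<^sup>+ix. h (case ix of (i, x) \<Rightarrow> g i x) \<partial>(U \<Otimes>\<^sub>M N))"
      unfolding K_def by (rule nn_integral_distr[OF g]) simp
    also have "\<dots> = (\<integral>\<^sup>+i. (\<integral>\<^sup>+x. h (g i x) \<partial>N) \<partial>U)"
      by (subst N.nn_integral_fst[symmetric]) (use measurable_compose[OF g that] in auto)
    also have "\<dots> = (\<Sum>i\<in>{0, 1, 2}. ennreal (1/3) * (\<integral>\<^sup>+x. h (g i x) \<partial>N))"
      unfolding U_def uniform_count_measure_def by (subst nn_integral_point_measure_finite) auto
    finally show ?thesis by (simp add: g_def distrib_left add.assoc)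
  qed
  have "K = N"
  proof (rule cdf_unique)
    show "real_distribution K" unfolding K_def by (rule UN.real_distribution_distr[OF g])
    show "real_distribution N" ..
    interpret K: real_distribution K by fact
    show "cdf K = cdf N"
    proof
      fix t
      have pullback: "(\<integral>\<^sup>+x. indicator {..t} (h x) \<partial>N) = emeasure N {x. h x \<le> t}"
        if [measurable]: "h \<in> borel_measurable borel" for h :: "real \<Rightarrow> real"
      proof -
        have "(\<integral>\<^sup>+x. indicator {..t} (h x) \<partial>N) = (\<integral>\<^sup>+x. indicator {x. h x \<le> t} x \<partial>N)"
          by (intro nn_integral_cong) (simp add: indicator_def)
        also have "\<dots> = emeasure N {x. h x \<le> t}"
          by (rule nn_integral_indicator) (use that in measurable)
        finally show ?thesis .
      qed
      have "emeasure K {..t} = (\<integral>\<^sup>+x. indicator {..t} x \<partial>K)"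
        by (rule nn_integral_indicator[symmetric]) simp
      also have "\<dots> = ennreal (1/3) * (emeasure N {x. (x - 2) / (x - 1) \<le> t}
          + emeasure N {x. - 1 / x \<le> t} + emeasure N {x. (x - 1) / (2 * x - 1) \<le> t})"
        by (subst K, measurable, subst (1 2 3) pullback; measurable)
      also have "\<dots> = ennreal (1/3 * (measure N {x. (x - 2) / (x - 1) \<le> t}
          + measure N {x. - 1 / x \<le> t} + measure N {x. (x - 1) / (2 * x - 1) \<le> t}))"
        by (simp add: N.emeasure_eq_measure ennreal_mult''[symmetric] ennreal_plus[symmetric] del: ennreal_plus)
      also have "1/3 * (measure N {x. (x - 2) / (x - 1) \<le> t}
          + measure N {x. - 1 / x \<le> t} + measure N {x. (x - 1) / (2 * x - 1) \<le> t}) = minkowski_ext t"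
        unfolding N_def measure_minkowski_a_le measure_minkowski_b_le measure_minkowski_c_le
        by (auto simp: minkowski_ext_values field_simps)
      finally have "measure K {..t} = minkowski_ext t"
        using measure_minkowski_Iic[of t] measure_nonneg[of minkowski_measure_real "{..t}"]
        by (simp add: measure_def)
      then show "cdf K t = cdf N t" by (simp add: cdf_def N_def measure_minkowski_Iic)
    qed
  qed
  then show ?thesis using K[of f] by simp
qed

section \<open>The action on the projective line\<close>

lemma abs_proj_line_eq_iff:
  assumes "u \<noteq> 0" "v \<noteq> 0"
  shows "abs_proj_line u = abs_proj_line v \<longleftrightarrow> (\<exists>c. c \<noteq> 0 \<and> v = c *\<^sub>R u)"
proof -
  have "\<exists>c::real. c \<noteq> 0 \<and> w = c *\<^sub>R w" for w :: "real^2" by (rule exI[of _ 1]) simp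
  then show ?thesis using Quotient3_rel[OF Quotient3_proj_line, of u v] assms by auto
qed

lemma psl_class_eq: "psl_class A = {A, - A}"
proof -
  have "- mat 1 ** A = - A"
    using matrix_mul_lid[of A] by (simp add: vec_eq_iff matrix_matrix_mult_def sum_negf)
  then show ?thesis by (simp add: psl_class_def r_coset_def SL2R_def insert_commute)
qed

lemma psl_class_eqD: "psl_class A = psl_class B \<Longrightarrow> A = B \<or> A = - B"
  unfolding psl_class_eq by blast

lemma det_one_mult_nonzero:
  fixes A :: "real^2^2"
  assumes "det A = 1" "v \<noteq> 0"
  shows "A *v v \<noteq> 0"
proof -
  have "inj ((*v) A)" using assms(1) by (intro inj_matrix_vector_mult) (simp add: invertible_det_nz)
  then show ?thesis using assms(2) by (metis injD matrix_vector_mult_0_right)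
qed

lemma psl_act_abs:
  assumes "det A = 1" "v \<noteq> 0"
  shows "psl_act (psl_class A) (abs_proj_line v) = abs_proj_line (A *v v)"
  unfolding psl_act_def psl_class_eq
proof (rule the_equality)
  show "\<exists>B\<in>{A, - A}. \<exists>w. w \<noteq> 0 \<and> abs_proj_line v = abs_proj_line w \<and>
      abs_proj_line (A *v v) = abs_proj_line (B *v w)"
    using assms(2) by blast
next
  fix y
  assume "\<exists>B\<in>{A, - A}. \<exists>w. w \<noteq> 0 \<and> abs_proj_line v = abs_proj_line w \<and> y = abs_proj_line (B *v w)"
  then obtain B w where B: "B = A \<or> B = - A" and w: "w \<noteq> 0" "abs_proj_line v = abs_proj_line w"
    and y: "y = abs_proj_line (B *v w)" by blast
  obtain c where c: "c \<noteq> 0" "w = c *\<^sub>R v" using abs_proj_line_eq_iff[OF assms(2) w(1)] w(2) by blast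
  have "(- A) *v w = - (A *v w)" by (simp add: vec_eq_iff matrix_vector_mult_def sum_negf)
  moreover have "A *v w = c *\<^sub>R (A *v v)" unfolding c(2) by (rule matrix_vector_mult_scaleR)
  ultimately have "B *v w = c *\<^sub>R (A *v v) \<or> B *v w = (- c) *\<^sub>R (A *v v)" using B by auto
  then obtain d where d: "d \<noteq> 0" "B *v w = d *\<^sub>R (A *v v)" using c(1) by (metis neg_equal_0_iff_equal)
  have "A *v v \<noteq> 0" by (rule det_one_mult_nonzero[OF assms])
  then have "abs_proj_line (A *v v) = abs_proj_line (d *\<^sub>R (A *v v))"
    using d(1) by (subst abs_proj_line_eq_iff) auto
  then show "y = abs_proj_line (A *v v)" by (simp add: y d(2))
qed

text \<open>
The action is continuous: in the quotient topology, preimages of open sets are tested on \<open>real^2\<close>,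
where \<open>A\<close> acts by a continuous map that avoids the origin.
\<close>

lemma psl_act_measurable:
  assumes "det A = 1"
  shows "psl_act (psl_class A) \<in> borel_measurable borel"
proof (rule borel_measurable_continuous_onI)
  have "open (psl_act (psl_class A) -` U)" if "open U" for U
  proof -
    define S where "S = {v :: real^2. v \<noteq> 0 \<and> abs_proj_line v \<in> U}"
    have "{v. v \<noteq> 0 \<and> abs_proj_line v \<in> psl_act (psl_class A) -` U} = (*v) A -` S"
    proof (rule Set.set_eqI)
      fix v
      show "v \<in> {v. v \<noteq> 0 \<and> abs_proj_line v \<in> psl_act (psl_class A) -` U} \<longleftrightarrow> v \<in> (*v) A -` S"
        by (cases "v = 0") (simp_all add: S_def psl_act_abs[OF assms] det_one_mult_nonzero[OF assms])
    qed
    moreover have "open ((*v) A -` S)"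
      using that unfolding S_def open_proj_line_def[symmetric]
      by (intro open_vimage matrix_vector_mult_linear_continuous_on) (simp add: open_proj_line_def)
    ultimately show ?thesis by (simp add: open_proj_line_def)
  qed
  then show "continuous_on UNIV (psl_act (psl_class A))"
    by (simp add: continuous_on_open_vimage)
qed

lemma proj_of_real_measurable: "proj_of_real \<in> borel_measurable borel"
proof (rule borel_measurable_continuous_onI)
  have "vector [t, 1] = t *\<^sub>R axis 1 1 + (axis 2 1 :: real^2)" for t
    by (simp add: vec_eq_iff forall_2 axis_def)
  then have cont: "continuous_on UNIV (\<lambda>t. vector [t, 1] :: real^2)"
    by (simp only:) (intro continuous_intros)
  have "open (proj_of_real -` U)" if "open U" for U
  proof -
    have "(vector [t, 1] :: real^2) \<noteq> 0" for t by (simp add: vec_eq_iff forall_2)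
    then have "proj_of_real -` U = (\<lambda>t. vector [t, 1]) -` {v :: real^2. v \<noteq> 0 \<and> abs_proj_line v \<in> U}"
      by (auto simp: proj_of_real_def)
    then show ?thesis
      using that open_vimage[OF _ cont, of "{v. v \<noteq> 0 \<and> abs_proj_line v \<in> U}"]
      by (simp only: open_proj_line_def)
  qed
  then show "continuous_on UNIV proj_of_real" by (simp add: continuous_on_open_vimage)
qed

lemma psl_act_proj_of_real:
  assumes "p * s - q * r = 1" "r * x + s \<noteq> 0"
  shows "psl_act (psl_class (vector [vector [p, q], vector [r, s]])) (proj_of_real x)
    = proj_of_real ((p * x + q) / (r * x + s))"
proof -
  let ?A = "vector [vector [p, q], vector [r, s]] :: real^2^2"
  have det: "det ?A = 1" using assms(1) by (simp add: det_2)
  have nz: "(vector [t, 1] :: real^2) \<noteq> 0" for t by (simp add: vec_eq_iff forall_2)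
  have "?A *v vector [x, 1] = (r * x + s) *\<^sub>R vector [(p * x + q) / (r * x + s), 1]"
    using assms(2) by (simp add: vec_eq_iff forall_2 matrix_vector_mult_def sum_2)
  moreover have "abs_proj_line ((r * x + s) *\<^sub>R vector [t, 1]) = proj_of_real t" for t
    unfolding proj_of_real_def
    using assms(2) nz[of t] by (subst eq_commute, subst abs_proj_line_eq_iff) auto
  ultimately show ?thesis
    using psl_act_abs[OF det nz] by (simp add: proj_of_real_def)
qed

lemma farey_generators_distinct: "farey_a \<noteq> farey_b" "farey_a \<noteq> farey_c" "farey_b \<noteq> farey_c"
  unfolding farey_a_def farey_b_def farey_c_def
  by (rule notI, drule psl_class_eqD, simp add: vec_eq_iff forall_2)+

text \<open>
The action agrees with the fractional linear formula except at the pole \<open>x = - s / r\<close>, which has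
measure \<open>0\<close>.
\<close>

lemma nn_integral_psl_act:
  fixes f :: "proj_line \<Rightarrow> ennreal"
  assumes f: "f \<in> borel_measurable borel" and det: "p * s - q * r = 1"
  shows "(\<integral>\<^sup>+x. f (psl_act (psl_class (vector [vector [p, q], vector [r, s]])) x) \<partial>minkowski_measure)
    = (\<integral>\<^sup>+x. f (proj_of_real ((p * x + q) / (r * x + s))) \<partial>minkowski_measure_real)"
proof -
  let ?A = "vector [vector [p, q], vector [r, s]] :: real^2^2"
  have det_A: "det ?A = 1" using det by (simp add: det_2)
  have "(\<integral>\<^sup>+x. f (psl_act (psl_class ?A) x) \<partial>minkowski_measure)
      = (\<integral>\<^sup>+x. f (psl_act (psl_class ?A) (proj_of_real x)) \<partial>minkowski_measure_real)"
    unfolding minkowski_measure_def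
    by (rule nn_integral_distr)
      (simp_all add: proj_of_real_measurable measurable_compose[OF psl_act_measurable[OF det_A] f])
  also have "\<dots> = (\<integral>\<^sup>+x. f (proj_of_real ((p * x + q) / (r * x + s))) \<partial>minkowski_measure_real)"
  proof (rule nn_integral_cong_AE)
    have "AE x in minkowski_measure_real. r * x + s \<noteq> 0"
    proof (cases "r = 0")
      case True
      then show ?thesis using det by (intro AE_I2) auto
    next
      case False
      show ?thesis
        using AE_minkowski_neq[of "- s / r"]
        by eventually_elim (use False in \<open>auto simp: field_simps add_eq_0_iff\<close>)
    qed
    then show "AE x in minkowski_measure_real. f (psl_act (psl_class ?A) (proj_of_real x))
        = f (proj_of_real ((p * x + q) / (r * x + s)))"
      by eventually_elim (simp add: psl_act_proj_of_real[OF det])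
  qed
  finally show ?thesis .
qed

text \<open>
Three distinct atoms of mass \<open>1/3\<close> exhaust a probability measure.
\<close>

lemma nn_integral_three_atoms:
  assumes "prob_space \<mu>" and sets: "sets \<mu> = Pow (space \<mu>)"
    and dist: "a \<noteq> b" "a \<noteq> c" "b \<noteq> c"
    and third: "measure \<mu> {a} = 1/3" "measure \<mu> {b} = 1/3" "measure \<mu> {c} = 1/3"
  shows "(\<integral>\<^sup>+g. h g \<partial>\<mu>) = ennreal (1/3) * (h a + h b + h c)"
proof -
  interpret prob_space \<mu> by fact
  have atom: "{g} \<in> sets \<mu>" if "measure \<mu> {g} = 1/3" for g
    using that measure_notin_sets[of "{g}" \<mu>] by auto
  have abc: "{g} \<in> sets \<mu>" "measure \<mu> {g} = 1/3" if "g \<in> {a, b, c}" for g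
    using that atom third by auto
  have "measure \<mu> {a, b, c} = (\<Sum>g\<in>{a, b, c}. measure \<mu> {g})"
    by (rule finite_measure_eq_sum_singleton) (use abc in auto)
  also have "\<dots> = 1" using dist third by simp
  finally have "AE g in \<mu>. g \<in> {a, b, c}"
    by (rule prob_eq_1[THEN iffD1, rotated]) (use abc(1) sets in auto)
  then have "(\<integral>\<^sup>+g. h g \<partial>\<mu>) = (\<integral>\<^sup>+g. h g * indicator {a, b, c} g \<partial>\<mu>)"
    by (intro nn_integral_cong_AE, eventually_elim) (simp add: indicator_def)
  also have "\<dots> = (\<Sum>g\<in>{a, b, c}. h g * emeasure \<mu> {g})"
    by (rule nn_integral_indicator_finite) (use abc(1) in auto)
  also have "\<dots> = (\<Sum>g\<in>{a, b, c}. ennreal (1/3) * h g)"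
    by (intro sum.cong refl) (simp add: emeasure_eq_measure abc(2) mult.commute)
  also have "\<dots> = ennreal (1/3) * (h a + h b + h c)"
    using dist by (simp add: distrib_left add.assoc)
  finally show ?thesis .
qed

theorem theorem2p2:
  fixes \<mu> :: "(real^2^2) set measure"
  assumes "prob_space \<mu>"
    and "space \<mu> = farey_group"
    and "sets \<mu> = Pow farey_group"
    and "measure \<mu> {farey_a} = 1 / 3"
    and "measure \<mu> {farey_b} = 1 / 3"
    and "measure \<mu> {farey_c} = 1 / 3"
  shows "psl_convolution \<mu> minkowski_measure = minkowski_measure"
  unfolding psl_convolution_def
proof (rule the_equality)
  have sets: "sets minkowski_measure = sets borel" by (simp add: minkowski_measure_def)
  have stationary: "(\<integral>\<^sup>+x. f x \<partial>minkowski_measure)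
      = (\<integral>\<^sup>+g. (\<integral>\<^sup>+x. f (psl_act g x) \<partial>minkowski_measure) \<partial>\<mu>)"
    if f: "f \<in> borel_measurable borel" for f :: "proj_line \<Rightarrow> ennreal"
  proof -
    have "(\<integral>\<^sup>+g. (\<integral>\<^sup>+x. f (psl_act g x) \<partial>minkowski_measure) \<partial>\<mu>)
        = ennreal (1/3) * ((\<integral>\<^sup>+x. f (psl_act farey_a x) \<partial>minkowski_measure)
          + (\<integral>\<^sup>+x. f (psl_act farey_b x) \<partial>minkowski_measure)
          + (\<integral>\<^sup>+x. f (psl_act farey_c x) \<partial>minkowski_measure))"
      using assms by (intro nn_integral_three_atoms farey_generators_distinct) simp_all
    also have "\<dots> = (\<integral>\<^sup>+x. f (proj_of_real x) \<partial>minkowski_measure_real)"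
      using nn_integral_psl_act[OF f, of 1 "- 1" "- 2" 1] nn_integral_psl_act[OF f, of 0 0 "- 1" 1]
        nn_integral_psl_act[OF f, of 1 "- 1" "- 1" 2]
        nn_integral_minkowski_stationary[OF measurable_compose[OF proj_of_real_measurable f]]
      by (simp add: farey_a_def farey_b_def farey_c_def)
    also have "\<dots> = (\<integral>\<^sup>+x. f x \<partial>minkowski_measure)"
      unfolding minkowski_measure_def
      by (rule nn_integral_distr[symmetric]) (simp_all add: proj_of_real_measurable f)
    finally show ?thesis by simp
  qed
  then show "sets minkowski_measure = sets borel \<and>
    (\<forall>f \<in> borel_measurable borel. (\<integral>\<^sup>+x. f x \<partial>minkowski_measure)
      = (\<integral>\<^sup>+g. (\<integral>\<^sup>+x. f (psl_act g x) \<partial>minkowski_measure) \<partial>\<mu>))"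
    using sets by simp
  fix \<nu> :: "proj_line measure"
  assume \<nu>: "sets \<nu> = sets borel \<and>
    (\<forall>f \<in> borel_measurable borel. (\<integral>\<^sup>+x. f x \<partial>\<nu>)
      = (\<integral>\<^sup>+g. (\<integral>\<^sup>+x. f (psl_act g x) \<partial>minkowski_measure) \<partial>\<mu>))"
  show "\<nu> = minkowski_measure"
  proof (rule measure_eqI)
    show "sets \<nu> = sets minkowski_measure" using \<nu> sets by simp
    fix A assume "A \<in> sets \<nu>"
    then have A: "A \<in> sets borel" "A \<in> sets \<nu>" "A \<in> sets minkowski_measure" using \<nu> sets by simp_all
    have ind: "(indicator A :: proj_line \<Rightarrow> ennreal) \<in> borel_measurable borel"
      using A(1) by (rule borel_measurable_indicator)
    have "(\<integral>\<^sup>+x. indicator A x \<partial>\<nu>)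
        = (\<integral>\<^sup>+g. (\<integral>\<^sup>+x. indicator A (psl_act g x) \<partial>minkowski_measure) \<partial>\<mu>)"
      using \<nu> ind by blast
    then have "(\<integral>\<^sup>+x. indicator A x \<partial>\<nu>) = (\<integral>\<^sup>+x. indicator A x \<partial>minkowski_measure)"
      using stationary[OF ind] by (simp only:)
    then show "emeasure \<nu> A = emeasure minkowski_measure A" using A by simp
  qed
qed

end
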